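(* For every integer $n\ge1$, the number of domino tilings of the Aztec diamond $AD(n+1)$ that are invariant under both the reflection $t$ and the half-turn $r^2$ equals \[\|C'_n\|_{l^{1/2}}=\sum_{\substack{\epsilon\in\{0,1\}^{2n+1}\\ \epsilon_{n+1}=0}} C'_n(\epsilon)+\sum_{\substack{\epsilon\in\{0,1\}^{2n+1}\\ \epsilon_{n+1}=1}} 2\,C'_n(\epsilon).\]
   Context: $AD(m)$ is the union of all unit lattice squares $[i,i+1]\times[j,j+1]$ ($i,j\in\mathbb{Z}$) contained in $|x|+|y|\le m+1$; domino tilings cover it by $1\times2$ or $2\times1$ dominoes without gaps or overlaps. $t$ is the reflection across the line $x=0$, and $r^2$ is rotation by $180^\circ$ about the origin; invariance under both is equivalent to invariance under reflections across both lines $x=0$ and $y=0$. For $m\ge1$, $\mathbb{Z}\langle\{0,1\}^m\rangle$ is the free abelian group with basis the binary sequences of length $m$; maps on basis elements extend $\mathbb{Z}$-linearly and functions $\{0,1\}^m\to\mathbb{Z}_{\ge0}$ extend to homomorphisms to $\mathbb{Z}$. Concatenation of sequences is written $(\alpha,\beta)$. (i) $R_m(\epsilon_1,\ldots,\epsilon_m)=(1-\epsilon_1,\ldots,1-\epsilon_m)$. (ii) For $m\ge2$, $1\le i\le m-1$: $E_m^i(\epsilon)=\epsilon+\epsilon'$ if $(\epsilon_i,\epsilon_{i+1})=(0,0)$, with $\epsilon'$ equal to $\epsilon$ with entries $i,i+1$ replaced by $1,1$; $E_m^i(\epsilon)=\epsilon$ otherwise. $E_m=E_m^{m-1}\circ\cdots\circ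 E_m^1$. (iii) For $m\ge4$, $K_m:\mathbb{Z}\langle\{0,1\}^m\rangle\to\mathbb{Z}\langle\{0,1\}^{m-2}\rangle$: $K_m(\epsilon)=0$ if $(\epsilon_1,\epsilon_2)=(0,1)$ or $(\epsilon_{m-1},\epsilon_m)=(1,0)$; otherwise $K_m(\epsilon)=(a,\epsilon_3,\ldots,\epsilon_{m-2},b)$ with $a=0$ if $(\epsilon_1,\epsilon_2)=(1,0)$, $a=1$ if $(\epsilon_1,\epsilon_2)\in\{(0,0),(1,1)\}$, $b=0$ if $(\epsilon_{m-1},\epsilon_m)=(0,1)$, $b=1$ if $(\epsilon_{m-1},\epsilon_m)\in\{(0,0),(1,1)\}$. (iv) Middle contraction $mK_m:\mathbb{Z}\langle\{0,1\}^{2m+1}\rangle\to\mathbb{Z}\langle\{0,1\}^{2m}\rangle$ ($m\ge1$): for $\alpha,\beta\in\{0,1\}^{m-1}$, $mK_m(\alpha,abc,\beta)=(\alpha,\gamma,\beta)$ where the middle triple $abc$ is replaced according to $111\mapsto11$, $100\mapsto11$, $001\mapsto11$, $011\mapsto01$, $110\mapsto10$, $010\mapsto00$, while $mK_m(\alpha,000,\beta)=(\alpha,01,\beta)+(\alpha,10,\beta)$ and $mK_m(\alpha,101,\beta)=0$. (v) Central contraction $cK_m:\mathbb{Z}\langle\{0,1\}^{2m}\rangle\to\mathbb{Z}\langle\{0,1\}^{2m-1}\rangle$ ($m\ge1$): for $\alpha,\beta\in\{0,1\}^{m-1}$, $cK_m(\alpha,01,\beta)=cK_m(\alpha,10,\beta)=(\alpha,1,\beta)$,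 $cK_m(\alpha,11,\beta)=(\alpha,0,\beta)$, $cK_m(\alpha,00,\beta)=0$. (vi) $(R_m\otimes\mathrm{id}\otimes R_m)(\alpha,c,\beta)=(R_m\alpha,c,R_m\beta)$ for $\alpha,\beta\in\{0,1\}^m$, $c\in\{0,1\}$; and for $\alpha,\beta\in\{0,1\}^m$, if $E_m(\alpha)=\sum_\gamma a_\gamma\gamma$ and $E_m(\beta)=\sum_\delta b_\delta\delta$ then $(E_m\otimes E_m)(\alpha,\beta)=\sum_{\gamma,\delta}a_\gamma b_\delta(\gamma,\delta)$. (vii) $C'_1:\{0,1\}^3\to\mathbb{Z}_{\ge0}$ has $C'_1(1,1,1)=C'_1(1,0,0)=C'_1(0,0,1)=1$ and is $0$ elsewhere. $C'_2:\{0,1\}^5\to\mathbb{Z}_{\ge0}$ has $C'_2(0,0,1,0,1)=C'_2(1,0,1,0,0)=C'_2(1,0,1,1,1)=C'_2(1,1,1,0,1)=1$, $C'_2(1,0,0,0,1)=2$, and is $0$ elsewhere. For $n\ge1$, $C'_{n+2}=C'_n\circ(R_n\otimes\mathrm{id}\otimes R_n)\circ cK_{n+1}\circ(E_{n+1}\otimes E_{n+1})\circ mK_{n+1}\circ K_{2n+5}$. *)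

theory Defs
  imports "HOL-Analysis.Analysis" "HOL-Library.Poly_Mapping" "HOL-Library.Z2"
begin

definition unit_square :: "int \<Rightarrow> int \<Rightarrow> (real \<times> real) set" where
  "unit_square i j = {of_int i..of_int i + 1} \<times> {of_int j..of_int j + 1}"

definition aztec_diamond :: "nat \<Rightarrow> (real \<times> real) set" where
  "aztec_diamond m =
     \<Union>{unit_square i j | i j. unit_square i j \<subseteq> {(x, y). \<bar>x\<bar> + \<bar>y\<bar> \<le> real m + 1}}"

definition is_domino :: "(real \<times> real) set \<Rightarrow> bool" where
  "is_domino D \<longleftrightarrow>
     (\<exists>i j. D = unit_square i j \<union> unit_square (i + 1) j \<or>
            D = unit_square i j \<union> unit_square i (j + 1))"

definition domino_tiling :: "(real \<times> real) set set \<Rightarrow> (real \<times> real) set \<Rightarrow> bool" where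
  "domino_tiling T S \<longleftrightarrow>
     (\<forall>D\<in>T. is_domino D) \<and> \<Union>T = S \<and>
     pairwise (\<lambda>D D'. interior D \<inter> interior D' = {}) T"

definition refl_t :: "real \<times> real \<Rightarrow> real \<times> real" where
  "refl_t = (\<lambda>(x, y). (- x, y))"

definition half_turn :: "real \<times> real \<Rightarrow> real \<times> real" where
  "half_turn = (\<lambda>(x, y). (- x, - y))"

definition invariant_under ::
    "(real \<times> real \<Rightarrow> real \<times> real) \<Rightarrow> (real \<times> real) set set \<Rightarrow> bool" where
  "invariant_under g T \<longleftrightarrow> (\<lambda>D. g ` D) ` T = T"

text \<open>
  The free abelian group on binary sequences is rendered by \<^typ>\<open>bit list \<Rightarrow>\<^sub>0 int\<close>, with
  \<^const>\<open>frag_of\<close> the basis elements and \<^const>\<open>frag_extend\<close> the linear extension of a map given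
  on basis elements. All lengths live in this one type: a map indexed by \<open>m\<close> has its intended
  meaning only on sequences of the length for which it is defined in the mathematics, and is
  applied only to those. Sequence entries are numbered from 1 in the mathematics and from 0 by
  \<^const>\<open>nth\<close>.
\<close>

definition lin_ext :: "(bit list \<Rightarrow> int) \<Rightarrow> (bit list \<Rightarrow>\<^sub>0 int) \<Rightarrow> int" where
  "lin_ext f v = (\<Sum>\<epsilon>\<in>Poly_Mapping.keys v. Poly_Mapping.lookup v \<epsilon> * f \<epsilon>)"

definition R_seq :: "bit list \<Rightarrow> bit list" where
  "R_seq \<epsilon> = map (\<lambda>e. 1 - e) \<epsilon>"

definition E_step :: "nat \<Rightarrow> bit list \<Rightarrow> (bit list \<Rightarrow>\<^sub>0 int)" where
  "E_step i \<epsilon> =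
     (if \<epsilon> ! (i - 1) = 0 \<and> \<epsilon> ! i = 0
      then frag_of \<epsilon> + frag_of (\<epsilon>[i - 1 := 1, i := 1])
      else frag_of \<epsilon>)"

text \<open>\<^const>\<open>fold\<close> applies the step for \<open>i = 1\<close> first and the step for \<open>i = m - 1\<close> last.\<close>

definition E_map :: "nat \<Rightarrow> (bit list \<Rightarrow>\<^sub>0 int) \<Rightarrow> (bit list \<Rightarrow>\<^sub>0 int)" where
  "E_map m = fold (\<lambda>i. frag_extend (E_step i)) [1..<m]"

definition K_map :: "nat \<Rightarrow> bit list \<Rightarrow> (bit list \<Rightarrow>\<^sub>0 int)" where
  "K_map m \<epsilon> =
     (let l = (\<epsilon> ! 0, \<epsilon> ! 1); r = (\<epsilon> ! (m - 2), \<epsilon> ! (m - 1)) in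
      if l = (0, 1) \<or> r = (1, 0) then 0
      else frag_of ([if l = (1, 0) then 0 else 1]
                    @ take (m - 4) (drop 2 \<epsilon>)
                    @ [if r = (0, 1) then 0 else 1]))"

definition mid_triple :: "bit list \<Rightarrow> (bit list \<Rightarrow>\<^sub>0 int)" where
  "mid_triple t =
     (if t = [1,1,1] \<or> t = [1,0,0] \<or> t = [0,0,1] then frag_of [1,1]
      else if t = [0,1,1] then frag_of [0,1]
      else if t = [1,1,0] then frag_of [1,0]
      else if t = [0,1,0] then frag_of [0,0]
      else if t = [0,0,0] then frag_of [0,1] + frag_of [1,0]
      else 0)"

definition mK_map :: "nat \<Rightarrow> bit list \<Rightarrow> (bit list \<Rightarrow>\<^sub>0 int)" where
  "mK_map m \<epsilon> =
     frag_extend (\<lambda>\<gamma>. frag_of (take (m - 1) \<epsilon> @ \<gamma> @ drop (m + 2) \<epsilon>))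
       (mid_triple (take 3 (drop (m - 1) \<epsilon>)))"

definition central_pair :: "bit list \<Rightarrow> (bit list \<Rightarrow>\<^sub>0 int)" where
  "central_pair p =
     (if p = [0,1] \<or> p = [1,0] then frag_of [1]
      else if p = [1,1] then frag_of [0]
      else 0)"

definition cK_map :: "nat \<Rightarrow> bit list \<Rightarrow> (bit list \<Rightarrow>\<^sub>0 int)" where
  "cK_map m \<epsilon> =
     frag_extend (\<lambda>\<gamma>. frag_of (take (m - 1) \<epsilon> @ \<gamma> @ drop (m + 1) \<epsilon>))
       (central_pair (take 2 (drop (m - 1) \<epsilon>)))"

definition R_id_R :: "nat \<Rightarrow> bit list \<Rightarrow> (bit list \<Rightarrow>\<^sub>0 int)" where
  "R_id_R m \<epsilon> = frag_of (R_seq (take m \<epsilon>) @ [\<epsilon> ! m] @ R_seq (drop (m + 1) \<epsilon>))"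

definition E_tensor_E :: "nat \<Rightarrow> bit list \<Rightarrow> (bit list \<Rightarrow>\<^sub>0 int)" where
  "E_tensor_E m \<epsilon> =
     (let a = E_map m (frag_of (take m \<epsilon>)); b = E_map m (frag_of (drop m \<epsilon>)) in
      \<Sum>\<gamma>\<in>Poly_Mapping.keys a. \<Sum>\<delta>\<in>Poly_Mapping.keys b.
        frag_cmul (Poly_Mapping.lookup a \<gamma> * Poly_Mapping.lookup b \<delta>) (frag_of (\<gamma> @ \<delta>)))"

text \<open>
  The value at index 0 is a dummy. In the last equation \<open>n = Suc k\<close> ranges over the positive
  integers and the left-hand side has index \<open>n + 2\<close>.
\<close>

fun C' :: "nat \<Rightarrow> bit list \<Rightarrow> int" where
  "C' 0 = (\<lambda>\<epsilon>. 0)"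
| "C' (Suc 0) = (\<lambda>\<epsilon>. if \<epsilon> \<in> {[1,1,1], [1,0,0], [0,0,1]} then 1 else 0)"
| "C' (Suc (Suc 0)) =
     (\<lambda>\<epsilon>. if \<epsilon> \<in> {[0,0,1,0,1], [1,0,1,0,0], [1,0,1,1,1], [1,1,1,0,1]} then 1
          else if \<epsilon> = [1,0,0,0,1] then 2
          else 0)"
| "C' (Suc (Suc (Suc k))) =
     (let n = Suc k in
      lin_ext (C' n)
      \<circ> frag_extend (R_id_R n)
      \<circ> frag_extend (cK_map (n + 1))
      \<circ> frag_extend (E_tensor_E (n + 1))
      \<circ> frag_extend (mK_map (n + 1))
      \<circ> K_map (2 * n + 5))"

end

theory Submission
  imports Defs
begin

text \<open>
  A tiling that is invariant under both axis reflections is determined by its part in the quadrant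
  of cells \<open>(i, j)\<close> with \<open>i, j \<ge> 0\<close> and \<open>i + j \<le> n\<close>: there it is a domino matching, except that cells on the
  axes may be covered by dominoes crossing the axis. The corner cell can cross in two directions,
  all other axis cells in one. This gives the weights 1 and 2, once one knows that \<open>C'\<^sub>n(\<epsilon>)\<close> is the
  number of domino matchings of the quadrant from which the axis cells with \<open>\<epsilon>\<^sub>k = 1\<close> are removed.

  The recursion for \<open>C'\<close> peels off the layer of axis cells, the rest being a translate of the
  quadrant of size \<open>n - 2\<close>. \<open>K\<close> matches the two extreme cells of the layer, \<open>mK\<close> the corner cell,
  each step \<open>E\<^sup>i\<close> decides whether an edge of the layer is used, and the cells that remain unmatched
  are forced to be matched with the next layer, which is described by \<open>cK\<close> and \<open>R\<close>.
\<close>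

section \<open>Perfect matchings\<close>

text \<open>All maps of the recursion are justified in one way: a basis sequence goes to the formal
  sum of the states left after a local decision, and the linearly extended number of completions
  does not change. The obstacle is that a step \<open>E\<close> settles an edge without always
  removing its cells, so the intermediate counts are not domino counts of a cell set. Hence the edge
  set \<open>G\<close> is a parameter here, and settled edges are deleted from it.

  When all edges inside the layer are settled, a cell still present (entry 0) must use up its
  partner in the next layer (entry 1 there); this is the complement \<open>R\<close>. The cells (0,
  1) and (1, 0) share the partner (1, 1), so two entries merge into one, and the value 0 of
  \<open>cK\<close> on 00 is their conflict. On the other pairs \<open>cK\<close> already records
  the complement, which is why \<open>R\<close> leaves the middle entry alone. Translating the rest
  back by (1, 1) lowers the bound on i + j by 2, hence the step from n + 2 to n and the two initial
  values.\<close>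

definition matchings :: "'a set set \<Rightarrow> 'a set \<Rightarrow> 'a set set set" where
  "matchings G S = {P. P \<subseteq> G \<and> disjoint P \<and> \<Union>P = S}"

definition num_matchings :: "'a set set \<Rightarrow> 'a set \<Rightarrow> int" where
  "num_matchings G S = int (card (matchings G S))"

lemma finite_matchings: "finite S \<Longrightarrow> finite (matchings G S)"
  by (rule finite_subset[of _ "Pow (Pow S)"]) (auto simp: matchings_def)

lemma num_matchings_empty: "{} \<notin> G \<Longrightarrow> num_matchings G {} = 1"
proof -
  assume "{} \<notin> G"
  then have "matchings G {} = {{}}"
    by (auto simp: matchings_def)
  then show ?thesis by (simp add: num_matchings_def)
qed

lemma num_matchings_cong:
  assumes "\<And>e. e \<subseteq> S \<Longrightarrow> e \<in> G \<longleftrightarrow> e \<in> G'"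
  shows "num_matchings G S = num_matchings G' S"
proof -
  have "matchings G S = matchings G' S"
    using assms unfolding matchings_def by blast
  then show ?thesis by (simp add: num_matchings_def)
qed

lemma matching_remove_edge:
  assumes "P \<in> matchings G S" "e \<in> P"
  shows "P - {e} \<in> matchings (G - {e}) (S - e)"
proof -
  have P: "P \<subseteq> G" "disjoint P" "\<Union>P = S"
    using assms(1) by (auto simp: matchings_def)
  moreover have "a \<inter> e = {}" if "a \<in> P - {e}" for a
    using that assms(2) P(2) by (simp add: disjoint_def)
  ultimately have "\<Union>(P - {e}) = S - e"
    by blast
  then show ?thesis
    using P by (auto simp: matchings_def disjoint_def)
qed

lemma matching_insert_edge:
  assumes "P \<in> matchings G (S - e)" "e \<in> G" "e \<subseteq> S"
  shows "insert e P \<in> matchings G S"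
proof -
  have P: "P \<subseteq> G" "disjoint P" "\<Union>P = S - e"
    using assms(1) by (auto simp: matchings_def)
  then have "a \<inter> e = {}" if "a \<in> P" for a
    using that by blast
  then have "disjoint (insert e P)"
    using P(2) by (auto simp: pairwise_insert disjnt_def)
  then show ?thesis
    using P assms(2,3) by (auto simp: matchings_def)
qed

lemma edge_notin_matching_diff: "P \<in> matchings G (S - e) \<Longrightarrow> e \<noteq> {} \<Longrightarrow> e \<notin> P"
  unfolding matchings_def by blast

lemma matchings_mono: "G \<subseteq> G' \<Longrightarrow> matchings G S \<subseteq> matchings G' S"
  unfolding matchings_def by blast

lemma card_insert_edge:
  assumes "e \<noteq> {}"
  shows "card (insert e ` matchings G (S - e)) = card (matchings G (S - e))"
proof (rule card_image, rule inj_onI)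
  fix P P' assume "P \<in> matchings G (S - e)" "P' \<in> matchings G (S - e)" "insert e P = insert e P'"
  with edge_notin_matching_diff[OF _ assms] show "P = P'"
    by (metis insert_ident)
qed

text \<open>A matching avoids \<open>e\<close>, or it is \<open>e\<close> together with a matching
  of the rest. The rest cannot use \<open>e\<close> again, so the edge may be deleted in both
  summands; these are the two terms of \<open>E_step\<close>.\<close>

lemma num_matchings_delete_edge:
  assumes "finite S" "e \<in> G" "e \<noteq> {}"
  shows "num_matchings G S = num_matchings (G - {e}) S
    + (if e \<subseteq> S then num_matchings (G - {e}) (S - e) else 0)"
proof (cases "e \<subseteq> S")
  case True
  have eq: "matchings G S = matchings (G - {e}) S \<union> insert e ` matchings (G - {e}) (S - e)"
  proof (intro equalityI subsetI)
    fix P assume P: "P \<in> matchings G S"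
    show "P \<in> matchings (G - {e}) S \<union> insert e ` matchings (G - {e}) (S - e)"
    proof (cases "e \<in> P")
      case True
      with matching_remove_edge[OF P True] show ?thesis
        by (metis UnI2 image_eqI insert_Diff)
    next
      case False
      with P show ?thesis unfolding matchings_def by blast
    qed
  next
    fix P assume "P \<in> matchings (G - {e}) S \<union> insert e ` matchings (G - {e}) (S - e)"
    then show "P \<in> matchings G S"
    proof
      assume "P \<in> insert e ` matchings (G - {e}) (S - e)"
      then obtain P' where "P = insert e P'" "P' \<in> matchings G (S - e)"
        using matchings_mono[of "G - {e}" G "S - e"] by auto
      then show ?thesis using matching_insert_edge[OF _ assms(2) True] by simp
    qed (use matchings_mono[of "G - {e}" G] in auto)
  qed
  have "matchings (G - {e}) S \<inter> insert e ` matchings (G - {e}) (S - e) = {}"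
    by (auto simp: matchings_def)
  then have "card (matchings G S) = card (matchings (G - {e}) S)
      + card (insert e ` matchings (G - {e}) (S - e))"
    unfolding eq using assms(1) by (intro card_Un_disjoint) (auto simp: finite_matchings)
  then show ?thesis
    using True card_insert_edge[OF assms(3), of "G - {e}" S] by (simp add: num_matchings_def)
next
  case False
  then show ?thesis
    using num_matchings_cong[of S G "G - {e}"] by auto
qed

lemma num_matchings_vertex:
  assumes "finite S" "v \<in> S"
  shows "num_matchings G S = (\<Sum>e | e \<in> G \<and> v \<in> e \<and> e \<subseteq> S. num_matchings G (S - e))"
proof -
  let ?N = "{e. e \<in> G \<and> v \<in> e \<and> e \<subseteq> S}"
  have fin: "finite ?N"
    using assms(1) by (intro finite_subset[of ?N "Pow S"]) auto
  have eq: "matchings G S = (\<Union>e\<in>?N. insert e ` matchings G (S - e))"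
  proof (intro equalityI subsetI)
    fix P assume P: "P \<in> matchings G S"
    then obtain e where e: "e \<in> P" "v \<in> e"
      using assms(2) unfolding matchings_def by blast
    then have "e \<in> ?N" using P unfolding matchings_def by blast
    moreover have "P - {e} \<in> matchings G (S - e)"
      using matching_remove_edge[OF P e(1)] matchings_mono[of "G - {e}" G] by blast
    ultimately show "P \<in> (\<Union>e\<in>?N. insert e ` matchings G (S - e))"
      using e(1) by (metis (no_types, lifting) UN_I image_eqI insert_Diff)
  qed (auto intro: matching_insert_edge)
  have "card (matchings G S) = (\<Sum>e\<in>?N. card (insert e ` matchings G (S - e)))"
    unfolding eq
  proof (rule card_UN_disjoint[OF fin])
    show "\<forall>e\<in>?N. finite (insert e ` matchings G (S - e))"
      using assms(1) by (auto simp: finite_matchings)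
    \<comment> \<open>Otherwise \<open>e'\<close> would be an edge of \<open>P\<close>, and
      \<open>P\<close> would cover \<open>v\<close>, although it is a matching of
      \<open>S - e\<close>.\<close>
    have sep: "insert e P \<noteq> insert e' P'"
      if "e \<in> ?N" "e' \<in> ?N" "e \<noteq> e'" "P \<in> matchings G (S - e)" "P' \<in> matchings G (S - e')"
      for e e' P P'
    proof
      assume "insert e P = insert e' P'"
      then have "e' \<in> P" using that(3) by auto
      then have "v \<in> \<Union>P" using that(2) by auto
      then show False using that(1,4) unfolding matchings_def by auto
    qed
    show "\<forall>e\<in>?N. \<forall>e'\<in>?N. e \<noteq> e' \<longrightarrow>
        insert e ` matchings G (S - e) \<inter> insert e' ` matchings G (S - e') = {}"
    proof (intro ballI impI equals0I)
      fix e e' X assume ee: "e \<in> ?N" "e' \<in> ?N" "e \<noteq> e'"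
        and "X \<in> insert e ` matchings G (S - e) \<inter> insert e' ` matchings G (S - e')"
      then obtain P P' where "P \<in> matchings G (S - e)" "P' \<in> matchings G (S - e')"
        "X = insert e P" "X = insert e' P'" by (elim IntE imageE) metis
      then show False using sep[OF ee] by metis
    qed
  qed
  also have "\<dots> = (\<Sum>e\<in>?N. card (matchings G (S - e)))"
    by (intro sum.cong refl card_insert_edge) auto
  finally show ?thesis by (simp add: num_matchings_def)
qed

text \<open>Every cell of \<open>W\<close> has a single possible partner, so the cells of
  \<open>W\<close> can be matched off one by one. A shared or missing partner rules out all
  matchings. The edge condition is restricted to subsets of \<open>I \<union> W\<close> so that it
  survives the shrinking of both sets in the induction.\<close>

lemma num_matchings_forced:
  assumes "finite W" "finite I" "W \<inter> I = {}"
    and "\<And>w e. w \<in> W \<Longrightarrow> w \<in> e \<Longrightarrow> e \<subseteq> I \<union> W \<Longrightarrow> e \<in> G \<longleftrightarrow> e = {w, q w}"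
    and "q ` W \<inter> W = {}"
  shows "num_matchings G (I \<union> W) =
    (if inj_on q W \<and> q ` W \<subseteq> I then num_matchings G (I - q ` W) else 0)"
  using assms
proof (induction W arbitrary: I rule: finite_induct)
  case empty
  then show ?case by simp
next
  case (insert w W)
  let ?S = "I \<union> insert w W"
  have edges: "{e. e \<in> G \<and> w \<in> e \<and> e \<subseteq> ?S} = (if q w \<in> I then {{w, q w}} else {})"
    using insert.prems(3)[of w] insert.prems(4) by auto
  have vert: "num_matchings G ?S = (if q w \<in> I then num_matchings G (?S - {w, q w}) else 0)"
    using insert.prems(1) insert.hyps
    by (subst num_matchings_vertex[of _ w]) (simp_all add: edges del: Un_insert_right)
  show ?case
  proof (cases "q w \<in> I")
    case True
    have eq: "?S - {w, q w} = (I - {q w}) \<union> W"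
      using insert.hyps insert.prems True by auto
    have "num_matchings G ((I - {q w}) \<union> W) =
      (if inj_on q W \<and> q ` W \<subseteq> I - {q w} then num_matchings G (I - {q w} - q ` W) else 0)"
    proof (rule insert.IH)
      fix v e assume "v \<in> W" "v \<in> e" "e \<subseteq> I - {q w} \<union> W"
      then show "e \<in> G \<longleftrightarrow> e = {v, q v}"
        using insert.prems(3)[of v e] by blast
    qed (use insert.prems in auto)
    moreover have "I - {q w} - q ` W = I - q ` insert w W" by auto
    moreover have "inj_on q W \<and> q ` W \<subseteq> I - {q w} \<longleftrightarrow>
        inj_on q (insert w W) \<and> q ` insert w W \<subseteq> I"
      using True insert.hyps(2) by (auto simp: image_iff)
    ultimately show ?thesis using vert eq True by simp
  next
    case False
    then show ?thesis using vert by simp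
  qed
qed

lemma num_matchings_image:
  assumes "inj f"
  shows "num_matchings ((`) f ` G) (f ` S) = num_matchings G S"
proof -
  have injs: "inj ((`) f)" by (rule inj_onI) (use assms in \<open>simp add: inj_image_eq_iff\<close>)
  have eq: "matchings ((`) f ` G) (f ` S) = (`) ((`) f) ` matchings G S"
  proof (intro equalityI subsetI)
    fix P assume P: "P \<in> matchings ((`) f ` G) (f ` S)"
    then obtain P' where P': "P' \<subseteq> G" "P = (`) f ` P'"
      unfolding matchings_def by (auto simp: subset_image_iff)
    have "disjoint P'"
    proof (rule disjointI)
      fix a b assume ab: "a \<in> P'" "b \<in> P'" "a \<noteq> b"
      then have "f ` a \<inter> f ` b = {}"
        using P assms unfolding P'(2) matchings_def disjoint_def by (auto simp: inj_image_eq_iff)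
      then show "a \<inter> b = {}" by blast
    qed
    moreover have "\<Union>P' = S"
      using P unfolding P'(2) matchings_def
      by (simp add: image_Union[symmetric] inj_image_eq_iff[OF assms])
    ultimately show "P \<in> (`) ((`) f) ` matchings G S"
      using P' unfolding matchings_def by auto
  next
    fix P assume "P \<in> (`) ((`) f) ` matchings G S"
    then obtain P' where P': "P' \<in> matchings G S" "P = (`) f ` P'" by blast
    have "disjoint P"
    proof (rule disjointI)
      fix a b assume "a \<in> P" "b \<in> P" and ne: "a \<noteq> b"
      then obtain a' b' where ab: "a' \<in> P'" "b' \<in> P'" "a = f ` a'" "b = f ` b'"
        using P'(2) by auto
      moreover from ab ne have "a' \<noteq> b'" by blast
      ultimately have "a' \<inter> b' = {}"
        using P'(1) unfolding matchings_def disjoint_def by simp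
      then show "a \<inter> b = {}"
        using assms ab by (simp add: image_Int[symmetric])
    qed
    then show "P \<in> matchings ((`) f ` G) (f ` S)"
      using P' unfolding matchings_def by auto
  qed
  have "inj ((`) ((`) f))" by (rule inj_onI) (use injs in \<open>simp add: inj_image_eq_iff\<close>)
  then show ?thesis
    unfolding num_matchings_def eq by (simp add: card_image inj_on_subset)
qed

section \<open>Linear extension\<close>

text \<open>Coefficients may cancel, so the support of a sum can be smaller than the union of the
  supports. Summation over a common finite superset makes additivity a termwise fact.\<close>

lemma lin_ext_superset:
  assumes "finite A" "Poly_Mapping.keys v \<subseteq> A"
  shows "lin_ext f v = (\<Sum>\<epsilon>\<in>A. Poly_Mapping.lookup v \<epsilon> * f \<epsilon>)"
  unfolding lin_ext_def using assms
  by (intro sum.mono_neutral_left) (auto simp: in_keys_iff)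

lemma lin_ext_zero [simp]: "lin_ext f 0 = 0"
  by (simp add: lin_ext_def)

lemma lin_ext_frag_of [simp]: "lin_ext f (frag_of \<epsilon>) = f \<epsilon>"
  by (simp add: lin_ext_def)

lemma lin_ext_add: "lin_ext f (u + v) = lin_ext f u + lin_ext f v"
proof -
  let ?A = "Poly_Mapping.keys u \<union> Poly_Mapping.keys v"
  have "lin_ext f (u + v) = (\<Sum>\<epsilon>\<in>?A. Poly_Mapping.lookup (u + v) \<epsilon> * f \<epsilon>)"
    by (rule lin_ext_superset) (auto dest: subsetD[OF Poly_Mapping.keys_add])
  then show ?thesis
    by (simp add: lin_ext_superset[of ?A] lookup_add distrib_right sum.distrib)
qed

lemma lin_ext_cmul: "lin_ext f (frag_cmul c v) = c * lin_ext f v"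
  using lin_ext_superset[of "Poly_Mapping.keys v" "frag_cmul c v" f]
  by (simp add: keys_cmul lin_ext_def sum_distrib_left mult.assoc)

lemma lin_ext_sum: "lin_ext f (\<Sum>i\<in>A. g i) = (\<Sum>i\<in>A. lin_ext f (g i))"
  by (induction A rule: infinite_finite_induct) (auto simp: lin_ext_add)

text \<open>Turns a function composed with a chain of linear maps into nested evaluations, so that
  each map can be checked on one basis sequence at a time.\<close>

lemma lin_ext_frag_extend: "lin_ext f (frag_extend g v) = lin_ext (\<lambda>\<epsilon>. lin_ext f (g \<epsilon>)) v"
  by (simp add: frag_extend_def lin_ext_sum lin_ext_cmul) (simp add: lin_ext_def)

lemma lin_ext_cong:
  "(\<And>\<epsilon>. \<epsilon> \<in> Poly_Mapping.keys v \<Longrightarrow> f \<epsilon> = g \<epsilon>) \<Longrightarrow> lin_ext f v = lin_ext g v"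
  by (simp add: lin_ext_def)

text \<open>The tensor product becomes an iterated evaluation, which lets the two arms of the layer
  be treated one after the other.\<close>

lemma lin_ext_E_tensor_E:
  "lin_ext f (E_tensor_E m \<epsilon>) =
     lin_ext (\<lambda>\<gamma>. lin_ext (\<lambda>\<delta>. f (\<gamma> @ \<delta>)) (E_map m (frag_of (drop m \<epsilon>)))) (E_map m (frag_of (take m \<epsilon>)))"
  unfolding E_tensor_E_def Let_def
  by (simp add: lin_ext_sum lin_ext_cmul) (simp add: lin_ext_def sum_distrib_left mult.assoc)

text \<open>Lets the two summands of an \<open>E_step\<close> pass separately through the remaining
  steps.\<close>

lemma fold_frag_extend_add:
  "fold (\<lambda>i. frag_extend (g i)) is (u + v)
     = fold (\<lambda>i. frag_extend (g i)) is u + fold (\<lambda>i. frag_extend (g i)) is v"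
  by (induction "is" arbitrary: u v) (simp_all add: frag_extend_add)

lemma keys_E_map_length:
  assumes "\<gamma> \<in> Poly_Mapping.keys (E_map m (frag_of \<alpha>))"
  shows "length \<gamma> = length \<alpha>"
proof -
  have "\<forall>x\<in>Poly_Mapping.keys (fold (\<lambda>i. frag_extend (E_step i)) is v). length x = l"
    if "\<forall>x\<in>Poly_Mapping.keys v. length x = l" for "is" l v
    using that
  proof (induction "is" arbitrary: v)
    case (Cons i "is")
    have "\<forall>x\<in>Poly_Mapping.keys (E_step i y). length x = length y" for y
      using Poly_Mapping.keys_add[of "frag_of y" "frag_of (y[i - 1 := 1, i := 1])"]
      by (auto simp: E_step_def)
    then have "\<forall>x\<in>Poly_Mapping.keys (frag_extend (E_step i) v). length x = l"
      using Cons.prems keys_frag_extend[of "E_step i" v] by fastforce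
    then show ?case using Cons.IH by simp
  qed simp
  from this[of "frag_of \<alpha>" "length \<alpha>"] assms show ?thesis
    by (auto simp: E_map_def)
qed

section \<open>Cells selected by binary sequences\<close>

text \<open>Entry 0 marks a cell that is still present, entry 1 one that is gone. The enumeration
  \<open>c\<close> is arbitrary because sequences index the axis cells, a single arm of the layer,
  and later the dominoes that cross an axis.\<close>

definition zero_cells :: "(nat \<Rightarrow> 'a) \<Rightarrow> bit list \<Rightarrow> 'a set" where
  "zero_cells c \<epsilon> = {c k | k. k < length \<epsilon> \<and> \<epsilon> ! k = 0}"

lemma zero_cells_Nil [simp]: "zero_cells c [] = {}"
  by (simp add: zero_cells_def)

lemma zero_cells_append:
  "zero_cells c (\<alpha> @ \<beta>) = zero_cells c \<alpha> \<union> zero_cells (\<lambda>k. c (length \<alpha> + k)) \<beta>"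
proof (intro equalityI subsetI)
  fix x assume "x \<in> zero_cells c (\<alpha> @ \<beta>)"
  then obtain k where k: "x = c k" "k < length \<alpha> + length \<beta>" "(\<alpha> @ \<beta>) ! k = 0"
    by (auto simp: zero_cells_def)
  show "x \<in> zero_cells c \<alpha> \<union> zero_cells (\<lambda>k. c (length \<alpha> + k)) \<beta>"
  proof (cases "k < length \<alpha>")
    case True
    with k show ?thesis by (auto simp: zero_cells_def nth_append)
  next
    case False
    then have "\<exists>l. k = length \<alpha> + l" by presburger
    with k show ?thesis by (auto simp: zero_cells_def)
  qed
next
  fix x assume "x \<in> zero_cells c \<alpha> \<union> zero_cells (\<lambda>k. c (length \<alpha> + k)) \<beta>"
  then obtain k where "x = c k" "k < length \<alpha> + length \<beta>" "(\<alpha> @ \<beta>) ! k = 0"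
    by (auto simp: zero_cells_def nth_append split: if_splits)
  then show "x \<in> zero_cells c (\<alpha> @ \<beta>)"
    by (auto simp: zero_cells_def)
qed

lemma zero_cells_Cons [simp]:
  "zero_cells c (x # \<beta>) = (if x = 0 then {c 0} else {}) \<union> zero_cells (\<lambda>k. c (Suc k)) \<beta>"
  using zero_cells_append[of c "[x]" \<beta>] by (auto simp: zero_cells_def)

lemma finite_zero_cells [simp]: "finite (zero_cells c \<epsilon>)"
  by (simp add: zero_cells_def)

lemma zero_cells_cong:
  "(\<And>k. k < length \<epsilon> \<Longrightarrow> c k = d k) \<Longrightarrow> zero_cells c \<epsilon> = zero_cells d \<epsilon>"
  unfolding zero_cells_def by force

lemma image_zero_cells: "f ` zero_cells c \<epsilon> = zero_cells (\<lambda>k. f (c k)) \<epsilon>"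
  unfolding zero_cells_def by auto

section \<open>Settling the edges of a path of cells\<close>

definition path_edges :: "(nat \<Rightarrow> 'a) \<Rightarrow> nat \<Rightarrow> nat \<Rightarrow> 'a set set" where
  "path_edges c a b = (\<lambda>i. {c (i - 1), c i}) ` {a..<b}"

lemma lin_ext_E_map_matchings:
  assumes "inj c" "finite B" "range c \<inter> B = {}" "path_edges c 1 m \<subseteq> G" "length \<alpha> = m"
  shows "lin_ext (\<lambda>\<gamma>. num_matchings (G - path_edges c 1 m) (B \<union> zero_cells c \<gamma>))
           (E_map m (frag_of \<alpha>))
         = num_matchings G (B \<union> zero_cells c \<alpha>)"
proof -
  \<comment> \<open>Generalised to a start at step \<open>i\<close>, where the edges of the earlier
    steps are already deleted. The induction on \<open>m - i\<close> peels off the first remaining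
    step.\<close>
  have "lin_ext (\<lambda>\<gamma>. num_matchings (G - path_edges c 1 m) (B \<union> zero_cells c \<gamma>))
          (fold (\<lambda>i. frag_extend (E_step i)) [i..<m] (frag_of \<alpha>))
        = num_matchings (G - path_edges c 1 i) (B \<union> zero_cells c \<alpha>)"
    if "1 \<le> i" "i \<le> m" "length \<alpha> = m" for i \<alpha>
    using that
  proof (induction "m - i" arbitrary: i \<alpha>)
    case 0
    then show ?case by simp
  next
    case (Suc d)
    let ?F = "lin_ext (\<lambda>\<gamma>. num_matchings (G - path_edges c 1 m) (B \<union> zero_cells c \<gamma>))"
    let ?f = "fold (\<lambda>i. frag_extend (E_step i)) [Suc i..<m]"
    let ?e = "{c (i - 1), c i}"
    let ?\<beta> = "\<alpha>[i - 1 := 1, i := 1]"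
    have im: "i < m" using Suc by simp
    have IH: "?F (?f (frag_of \<beta>)) = num_matchings (G - path_edges c 1 (Suc i)) (B \<union> zero_cells c \<beta>)"
      if "length \<beta> = m" for \<beta>
      using Suc im that by (intro Suc.hyps(1)) auto
    have sub: "?e \<subseteq> B \<union> zero_cells c \<alpha> \<longleftrightarrow> \<alpha> ! (i - 1) = 0 \<and> \<alpha> ! i = 0"
    proof -
      have mem: "c k \<in> B \<union> zero_cells c \<alpha> \<longleftrightarrow> \<alpha> ! k = 0" if "k < m" for k
        using assms(1,3) that Suc.prems(3) by (auto simp: zero_cells_def dest: injD)
      show ?thesis using mem[of "i - 1"] mem[of i] im by auto
    qed
    have diff: "(B \<union> zero_cells c \<alpha>) - ?e = B \<union> zero_cells c ?\<beta>"
    proof -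
      have "zero_cells c \<alpha> - ?e = zero_cells c ?\<beta>"
        using assms(1) Suc.prems(3) im
        by (auto simp: zero_cells_def nth_list_update dest: injD split: if_splits) metis
      moreover have "B - ?e = B" using assms(3) by auto
      ultimately show ?thesis by auto
    qed
    have edges: "G - path_edges c 1 i - {?e} = G - path_edges c 1 (Suc i)"
      using Suc.prems(1) by (auto simp: path_edges_def atLeastLessThanSuc)
    \<comment> \<open>Injectivity of \<open>c\<close> ensures that the current edge is not among
      those deleted before.\<close>
    have "?e \<notin> path_edges c 1 i"
      using assms(1) Suc.prems(1) by (auto simp: path_edges_def doubleton_eq_iff inj_eq)
    moreover have "?e \<in> G" using assms(4) im Suc.prems(1) by (auto simp: path_edges_def)
    ultimately have "num_matchings (G - path_edges c 1 i) (B \<union> zero_cells c \<alpha>)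
        = num_matchings (G - path_edges c 1 (Suc i)) (B \<union> zero_cells c \<alpha>)
          + (if \<alpha> ! (i - 1) = 0 \<and> \<alpha> ! i = 0
             then num_matchings (G - path_edges c 1 (Suc i)) (B \<union> zero_cells c ?\<beta>) else 0)"
      by (subst num_matchings_delete_edge[of _ ?e]) (simp_all only: edges sub diff, use assms(2) in auto)
    also have "\<dots> = ?F (?f (E_step i \<alpha>))"
      using Suc.prems(3)
      by (simp add: E_step_def fold_frag_extend_add lin_ext_add IH del: One_nat_def)
    finally show ?case
      using im by (simp add: upt_conv_Cons)
  qed
  \<comment> \<open>For \<open>m = 0\<close> the general claim does not apply, but then there are
    neither steps nor edges.\<close>
  from this[of 1 \<alpha>] assms(5) show ?thesis
    by (cases m) (auto simp: E_map_def path_edges_def)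
qed

section \<open>Dominoes\<close>

text \<open>Combinatorial model: a unit square is represented by its lower left vertex. The link to
  the sets of real points is \<open>is_domino_iff\<close>.\<close>

definition dominoes :: "(int \<times> int) set set" where
  "dominoes = {{(i, j), (i + 1, j)} | i j. True} \<union> {{(i, j), (i, j + 1)} | i j. True}"

definition neighbours :: "int \<times> int \<Rightarrow> (int \<times> int) set" where
  "neighbours = (\<lambda>(i, j). {(i + 1, j), (i - 1, j), (i, j + 1), (i, j - 1)})"

lemma domino_iff_neighbours: "v \<in> e \<Longrightarrow> e \<in> dominoes \<longleftrightarrow> (\<exists>d\<in>neighbours v. e = {v, d})"
proof (cases v)
  case [simp]: (Pair i j)
  assume "v \<in> e"
  show ?thesis
  proof
    assume "e \<in> dominoes"
    then obtain a b where "e = {(a, b), (a + 1, b)} \<or> e = {(a, b), (a, b + 1)}"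
      unfolding dominoes_def by blast
    with \<open>v \<in> e\<close> have "e = {v, (i + 1, j)} \<or> e = {v, (i - 1, j)} \<or> e = {v, (i, j + 1)} \<or> e = {v, (i, j - 1)}"
      unfolding Pair by (elim disjE) (simp_all, elim disjE, simp_all add: insert_commute, elim disjE, simp_all add: insert_commute)
    then show "\<exists>d\<in>neighbours v. e = {v, d}"
      by (auto simp only: neighbours_def Pair prod.case)
  next
    assume "\<exists>d\<in>neighbours v. e = {v, d}"
    then consider "e = {(i, j), (i + 1, j)}" | "e = {(i - 1, j), (i - 1 + 1, j)}"
      | "e = {(i, j), (i, j + 1)}" | "e = {(i, j - 1), (i, j - 1 + 1)}"
      by (auto simp: neighbours_def)
    then show "e \<in> dominoes"
      unfolding dominoes_def by cases blast+
  qed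
qed

lemma empty_notin_dominoes [simp]: "{} \<notin> dominoes"
  by (auto simp: dominoes_def)

lemma num_matchings_dominoes:
  assumes "finite S" "v \<in> S"
  shows "num_matchings dominoes S = (\<Sum>d\<in>S \<inter> neighbours v. num_matchings dominoes (S - {v, d}))"
proof -
  have "v \<notin> neighbours v" by (auto simp: neighbours_def split: prod.splits)
  then have inj: "inj_on (\<lambda>d. {v, d}) (S \<inter> neighbours v)"
    by (auto simp: inj_on_def doubleton_eq_iff)
  have "{e. e \<in> dominoes \<and> v \<in> e \<and> e \<subseteq> S} = (\<lambda>d. {v, d}) ` (S \<inter> neighbours v)"
    using assms(2) domino_iff_neighbours[of v] by auto
  then show ?thesis
    by (simp add: num_matchings_vertex[OF assms, of dominoes] sum.reindex[OF inj])
qed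

lemma num_matchings_dominoes_shift:
  "num_matchings dominoes ((\<lambda>(i, j). (i + a, j + b)) ` S) = num_matchings dominoes S"
proof -
  let ?f = "\<lambda>(i::int, j::int). (i + a, j + b)"
  have "inj ?f" by (auto simp: inj_on_def)
  moreover have "(`) ?f ` dominoes = dominoes"
  proof (intro equalityI subsetI)
    fix e assume "e \<in> (`) ?f ` dominoes"
    then show "e \<in> dominoes" by (fastforce simp: dominoes_def)
  next
    fix e assume "e \<in> dominoes"
    then obtain i j where "e = {(i, j), (i + 1, j)} \<or> e = {(i, j), (i, j + 1)}"
      by (auto simp: dominoes_def)
    then have "e = ?f ` {(i - a, j - b), (i - a + 1, j - b)}
        \<or> e = ?f ` {(i - a, j - b), (i - a, j - b + 1)}" by auto
    moreover have "{(i - a, j - b), (i - a + 1, j - b)} \<in> dominoes"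
      "{(i - a, j - b), (i - a, j - b + 1)} \<in> dominoes" by (auto simp: dominoes_def)
    ultimately show "e \<in> (`) ?f ` dominoes" by blast
  qed
  ultimately show ?thesis using num_matchings_image[of ?f dominoes S] by simp
qed

section \<open>The quadrant\<close>

lemma R_seq_R_seq [simp]: "R_seq (R_seq \<epsilon>) = \<epsilon>"
proof -
  have "1 - (1 - x) = x" for x :: bit by (cases x) auto
  then show ?thesis by (simp add: R_seq_def o_def del: minus_bit_def)
qed

lemma length_R_seq [simp]: "length (R_seq \<epsilon>) = length \<epsilon>"
  by (simp add: R_seq_def)

lemma R_seq_append [simp]: "R_seq (\<alpha> @ \<beta>) = R_seq \<alpha> @ R_seq \<beta>"
  by (simp add: R_seq_def)

lemma nth_R_seq: "k < length \<epsilon> \<Longrightarrow> R_seq \<epsilon> ! k = 1 - \<epsilon> ! k"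
  by (simp add: R_seq_def)

lemma one_minus_bit_eq_0_iff: "1 - x = 0 \<longleftrightarrow> x = (1 :: bit)"
  by (cases "x = 0") auto

definition quadrant :: "nat \<Rightarrow> (int \<times> int) set" where
  "quadrant n = {(i, j). 0 \<le> i \<and> 0 \<le> j \<and> i + j \<le> int n}"

text \<open>For index \<open>n + 2\<close> this is \<open>quadrant n\<close> translated by (1, 1):
  what is left when the layer of axis cells is gone.\<close>

definition inner_quadrant :: "nat \<Rightarrow> (int \<times> int) set" where
  "inner_quadrant n = {(i, j). 1 \<le> i \<and> 1 \<le> j \<and> i + j \<le> int n}"

text \<open>The axis cells are listed from the top of the vertical axis through the corner (index \<open>n\<close>) to the
  right end of the horizontal one, matching the order of the entries of \<open>\<epsilon>\<close>.\<close>

definition axis_cell :: "nat \<Rightarrow> nat \<Rightarrow> int \<times> int" where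
  "axis_cell n k = (max 0 (int k - int n), max 0 (int n - int k))"

text \<open>Stated by removal of the ones rather than by collection of the zeros, since both the
  forced matches and the crossing dominoes remove cells from a quadrant.\<close>

definition region :: "nat \<Rightarrow> bit list \<Rightarrow> (int \<times> int) set" where
  "region n \<epsilon> = quadrant n - zero_cells (axis_cell n) (R_seq \<epsilon>)"

lemma finite_quadrant [simp]: "finite (quadrant n)"
  by (rule finite_subset[of _ "{0..int n} \<times> {0..int n}"]) (auto simp: quadrant_def)

lemma finite_inner_quadrant [simp]: "finite (inner_quadrant n)"
  by (rule finite_subset[of _ "{0..int n} \<times> {0..int n}"]) (auto simp: inner_quadrant_def)

lemma inj_axis_cell: "inj (axis_cell n)"
  by (rule injI) (auto simp: axis_cell_def max_def split: if_splits)

lemma quadrant_cases: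
  assumes "c \<in> quadrant n"
  obtains "c \<in> inner_quadrant n" | k where "k < 2 * n + 1" "c = axis_cell n k"
proof -
  obtain i j where c: "c = (i, j)" by fastforce
  consider "1 \<le> i" "1 \<le> j" | "i = 0" "0 \<le> j" "j \<le> int n" | "j = 0" "0 \<le> i" "i \<le> int n"
    using assms c by (force simp: quadrant_def)
  then show thesis
  proof cases
    case 1
    then show thesis using that(1) assms c by (auto simp: quadrant_def inner_quadrant_def)
  next
    case 2
    then show thesis using c by (intro that(2)[of "nat (int n - j)"]) (auto simp: axis_cell_def)
  next
    case 3
    then show thesis using c by (intro that(2)[of "nat (int n + i)"]) (auto simp: axis_cell_def)
  qed
qed

lemma axis_cell_notin_inner [simp]: "axis_cell n k \<notin> inner_quadrant m"
  by (auto simp: axis_cell_def inner_quadrant_def max_def)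

lemma axis_cell_in_quadrant: "k < 2 * n + 1 \<Longrightarrow> axis_cell n k \<in> quadrant n"
  by (auto simp: axis_cell_def quadrant_def max_def)

lemma inner_quadrant_subset: "inner_quadrant n \<subseteq> quadrant n"
  by (auto simp: inner_quadrant_def quadrant_def)

lemma axis_cell_in_zero_cells:
  "k < length \<epsilon> \<Longrightarrow> axis_cell n k \<in> zero_cells (axis_cell n) \<epsilon> \<longleftrightarrow> \<epsilon> ! k = 0"
  using inj_axis_cell[of n] by (auto simp: zero_cells_def inj_eq)

text \<open>A cell that is not removed has entry 0 only if the sequence reaches every axis cell,
  hence the exact length.\<close>

lemma region_eq:
  assumes "length \<epsilon> = 2 * n + 1"
  shows "region n \<epsilon> = inner_quadrant n \<union> zero_cells (axis_cell n) \<epsilon>"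
proof (intro equalityI subsetI)
  fix c assume c: "c \<in> region n \<epsilon>"
  then have "c \<in> quadrant n" by (simp add: region_def)
  then show "c \<in> inner_quadrant n \<union> zero_cells (axis_cell n) \<epsilon>"
  proof (cases rule: quadrant_cases)
    case (2 k)
    then show ?thesis
      using c assms by (simp add: region_def axis_cell_in_zero_cells nth_R_seq one_minus_bit_eq_0_iff)
  qed simp
next
  fix c assume "c \<in> inner_quadrant n \<union> zero_cells (axis_cell n) \<epsilon>"
  then consider "c \<in> inner_quadrant n" | k where "k < 2 * n + 1" "c = axis_cell n k" "\<epsilon> ! k = 0"
    using assms by (auto simp: zero_cells_def)
  then show "c \<in> region n \<epsilon>"
  proof cases
    case 1
    then show ?thesis
      using inner_quadrant_subset by (auto simp: region_def zero_cells_def)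
  next
    case (2 k)
    then show ?thesis
      using assms
      by (simp add: region_def axis_cell_in_quadrant axis_cell_in_zero_cells nth_R_seq one_minus_bit_eq_0_iff)
  qed
qed

abbreviation zero_cell :: "bit \<Rightarrow> 'a \<Rightarrow> 'a set" where
  "zero_cell x c \<equiv> (if x = 0 then {c} else {})"

text \<open>\<open>B\<close> is the only possible partner of \<open>A\<close>. If \<open>A\<close>
  is present, it takes \<open>B\<close> with it or, when \<open>B\<close> is gone, admits no
  matching; if \<open>A\<close> is gone, \<open>B\<close> stays as it is. This is the table of
  \<open>K_map\<close> at either end.\<close>

lemma num_matchings_leaf_pair:
  assumes "finite Y" "A \<notin> Y" "B \<notin> Y" "A \<noteq> B" "B \<in> neighbours A" "Y \<inter> neighbours A = {}"
  shows "num_matchings dominoes (Y \<union> zero_cell x A \<union> zero_cell y B) =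
    (if x = 0 \<and> y = 1 then 0
     else num_matchings dominoes (Y \<union> zero_cell (if x = 1 \<and> y = 0 then 0 else 1) B))"
proof (cases "x = 0")
  case True
  let ?S = "Y \<union> zero_cell x A \<union> zero_cell y B"
  have "A \<notin> neighbours A" by (auto simp: neighbours_def split: prod.splits)
  then have "?S \<inter> neighbours A = zero_cell y B" "?S - {A, B} = Y"
    using assms True by auto
  then show ?thesis
    using assms(1) True by (subst num_matchings_dominoes[of _ A]) auto
next
  case False
  then show ?thesis by auto
qed

text \<open>If \<open>M\<close> is present it must take \<open>L\<close> or \<open>R\<close>; both
  choices exist only for 000, and none for 101. If \<open>M\<close> is gone its entry is dropped.
  This is the table of \<open>mid_triple\<close>.\<close>

lemma num_matchings_corner:
  assumes "finite Y" "L \<notin> Y" "M \<notin> Y" "R \<notin> Y" "L \<noteq> M" "M \<noteq> R" "R \<noteq> L"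
    "L \<in> neighbours M" "R \<in> neighbours M" "Y \<inter> neighbours M = {}"
  shows "num_matchings dominoes (Y \<union> zero_cell x L \<union> zero_cell y M \<union> zero_cell z R) =
    lin_ext (\<lambda>\<gamma>. num_matchings dominoes (Y \<union> zero_cell (\<gamma> ! 0) L \<union> zero_cell (\<gamma> ! 1) R))
      (mid_triple [x, y, z])"
proof (cases "y = 0")
  case True
  define S where "S = Y \<union> zero_cell x L \<union> zero_cell y M \<union> zero_cell z R"
  have "M \<notin> neighbours M" by (auto simp: neighbours_def split: prod.splits)
  then have S: "S \<inter> neighbours M = zero_cell x L \<union> zero_cell z R"
    "S - {M, L} = Y \<union> zero_cell z R" "S - {M, R} = Y \<union> zero_cell x L" "M \<in> S" "finite S"
    unfolding S_def using assms True by auto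
  have "num_matchings dominoes S = (\<Sum>d\<in>zero_cell x L \<union> zero_cell z R. num_matchings dominoes (S - {M, d}))"
    using num_matchings_dominoes[of S M] S by simp
  also have "\<dots> = (\<Sum>d\<in>zero_cell x L. num_matchings dominoes (S - {M, d}))
      + (\<Sum>d\<in>zero_cell z R. num_matchings dominoes (S - {M, d}))"
    using assms(7) by (intro sum.union_disjoint) auto
  also have "\<dots> = (if x = 0 then num_matchings dominoes (Y \<union> zero_cell z R) else 0)
      + (if z = 0 then num_matchings dominoes (Y \<union> zero_cell x L) else 0)"
    by (simp add: S(2,3))
  finally have "num_matchings dominoes S =
      (if x = 0 then num_matchings dominoes (Y \<union> zero_cell z R) else 0)
      + (if z = 0 then num_matchings dominoes (Y \<union> zero_cell x L) else 0)" .
  then show ?thesis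
    unfolding S_def[symmetric] using True by (cases "x = 0"; cases "z = 0") (simp_all add: mid_triple_def lin_ext_add)
next
  case False
  then show ?thesis
    by (cases "x = 0"; cases "z = 0") (simp_all add: mid_triple_def)
qed

section \<open>Peeling off the axes\<close>

text \<open>The bound on i + j excludes the right neighbour of the top cell and the upper neighbour
  of the rightmost cell, so each end of the layer is a leaf.\<close>

lemma num_matchings_K_map:
  assumes "length \<epsilon> = 2 * n + 5"
  shows "num_matchings dominoes (inner_quadrant (n + 2) \<union> zero_cells (axis_cell (n + 2)) \<epsilon>) =
    lin_ext (\<lambda>\<delta>. num_matchings dominoes (inner_quadrant (n + 2) \<union> zero_cells (axis_cell (n + 1)) \<delta>))
      (K_map (2 * n + 5) \<epsilon>)"
proof -
  obtain w x \<mu> y z where \<epsilon>: "\<epsilon> = w # x # \<mu> @ [y, z]" and \<mu>: "length \<mu> = 2 * n + 1"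
  proof
    show "\<epsilon> = \<epsilon> ! 0 # \<epsilon> ! 1 # take (2 * n + 1) (drop 2 \<epsilon>) @ [\<epsilon> ! (2 * n + 3), \<epsilon> ! (2 * n + 4)]"
      using assms by (intro nth_equalityI) (auto simp: nth_Cons nth_append numeral_eq_Suc less_Suc_eq split: nat.splits)
  qed (use assms in auto)
  define Y where "Y = inner_quadrant (n + 2) \<union> zero_cells (axis_cell n) \<mu>"
  have finY: "finite Y" by (simp add: Y_def)
  \<comment> \<open>Besides the four cells treated separately, these are the other neighbours of the
    two end cells; their absence makes the ends leaves.\<close>
  have Y: "(0, int n + 1) \<notin> Y" "(0, int n + 2) \<notin> Y" "(0, int n + 3) \<notin> Y"
    "(1, int n + 2) \<notin> Y" "(-1, int n + 2) \<notin> Y"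
    "(int n + 1, 0) \<notin> Y" "(int n + 2, 0) \<notin> Y" "(int n + 3, 0) \<notin> Y"
    "(int n + 2, 1) \<notin> Y" "(int n + 2, -1) \<notin> Y"
    using \<mu> by (auto simp: Y_def inner_quadrant_def zero_cells_def axis_cell_def)
  let ?A = "(0, int n + 2)" and ?B = "(0, int n + 1)" and ?C = "(int n + 1, 0)" and ?D = "(int n + 2, 0)"
  let ?a = "if w = 1 \<and> x = 0 then 0 else 1 :: bit" and ?b = "if z = 1 \<and> y = 0 then 0 else 1 :: bit"
  have "zero_cells (axis_cell (n + 2)) \<epsilon> = zero_cell w ?A \<union> zero_cell x ?B \<union> zero_cells (axis_cell n) \<mu>
      \<union> zero_cell y ?C \<union> zero_cell z ?D"
  proof -
    have "(\<lambda>k. axis_cell (n + 2) (Suc (Suc k))) = axis_cell n"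
      "axis_cell (n + 2) 0 = ?A" "axis_cell (n + 2) (Suc 0) = ?B"
      "axis_cell n (2 * n + 1) = ?C" "axis_cell n (2 * n + 1 + Suc 0) = ?D"
      by (auto simp: axis_cell_def fun_eq_iff)
    then show ?thesis
      by (simp only: \<epsilon> zero_cells_append zero_cells_Cons zero_cells_Nil \<mu> Un_assoc Un_empty_right add_0_right)
  qed
  then have "num_matchings dominoes (inner_quadrant (n + 2) \<union> zero_cells (axis_cell (n + 2)) \<epsilon>)
    = num_matchings dominoes ((Y \<union> zero_cell y ?C \<union> zero_cell z ?D) \<union> zero_cell w ?A \<union> zero_cell x ?B)"
    by (simp add: Y_def Un_ac)
  also have "\<dots> = (if w = 0 \<and> x = 1 then 0 else
      num_matchings dominoes ((Y \<union> zero_cell y ?C \<union> zero_cell z ?D) \<union> zero_cell ?a ?B))"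
    using Y finY by (intro num_matchings_leaf_pair) (auto simp: neighbours_def add.commute)
  \<comment> \<open>The outer cell must come first in the leaf lemma, so the right end is read
    backwards as \<open>(z, y)\<close>.\<close>
  also have "num_matchings dominoes ((Y \<union> zero_cell y ?C \<union> zero_cell z ?D) \<union> zero_cell ?a ?B)
    = num_matchings dominoes ((Y \<union> zero_cell ?a ?B) \<union> zero_cell z ?D \<union> zero_cell y ?C)"
    by (simp only: Un_ac)
  also have "\<dots> = (if z = 0 \<and> y = 1 then 0 else
      num_matchings dominoes ((Y \<union> zero_cell ?a ?B) \<union> zero_cell ?b ?C))"
    using Y finY by (intro num_matchings_leaf_pair) (auto simp: neighbours_def add.commute)
  finally have lhs: "num_matchings dominoes (inner_quadrant (n + 2) \<union> zero_cells (axis_cell (n + 2)) \<epsilon>)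
    = (if w = 0 \<and> x = 1 \<or> z = 0 \<and> y = 1 then 0
       else num_matchings dominoes ((Y \<union> zero_cell ?a ?B) \<union> zero_cell ?b ?C))"
    by auto
  have "inner_quadrant (n + 2) \<union> zero_cells (axis_cell (n + 1)) (a # \<mu> @ [b])
      = Y \<union> zero_cell a ?B \<union> zero_cell b ?C" for a b
  proof -
    have "(\<lambda>k. axis_cell (n + 1) (Suc k)) = axis_cell n"
      "axis_cell (n + 1) 0 = ?B" "axis_cell n (2 * n + 1) = ?C"
      by (auto simp: axis_cell_def fun_eq_iff)
    then show ?thesis
      by (simp only: Y_def zero_cells_append zero_cells_Cons zero_cells_Nil \<mu> Un_ac Un_empty_right Un_empty_left add_0_right)
  qed
  moreover have "K_map (2 * n + 5) \<epsilon> = (if w = 0 \<and> x = 1 \<or> z = 0 \<and> y = 1 then 0 else frag_of (?a # \<mu> @ [?b]))"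
    using \<mu> by (auto simp: K_map_def \<epsilon> nth_append numeral_eq_Suc)
  ultimately show ?thesis
    unfolding lhs by simp
qed

lemma keys_K_map_length:
  assumes "\<delta> \<in> Poly_Mapping.keys (K_map (2 * n + 5) \<epsilon>)" "length \<epsilon> = 2 * n + 5"
  shows "length \<delta> = 2 * n + 3"
  using assms by (auto simp: K_map_def Let_def split: if_splits)

lemma split_middle:
  assumes "length \<delta> = m + k + m"
  obtains \<alpha> \<mu> \<beta> where "\<delta> = \<alpha> @ \<mu> @ \<beta>" "length \<alpha> = m" "length \<mu> = k" "length \<beta> = m"
proof
  show "\<delta> = take m \<delta> @ take k (drop m \<delta>) @ drop (m + k) \<delta>"
    by (metis append_take_drop_id drop_drop add.commute)
qed (use assms in auto)

text \<open>With \<open>bottom_cell\<close>, the two arms of the layer without the corner, both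
  listed in the order of the sequence: the left arm downwards to (0, 1), the bottom arm from (1, 0)
  to the right.\<close>

definition left_cell :: "nat \<Rightarrow> nat \<Rightarrow> int \<times> int" where
  "left_cell n k = (0, int n + 1 - int k)"

definition bottom_cell :: "nat \<Rightarrow> int \<times> int" where
  "bottom_cell k = (int k + 1, 0)"

text \<open>The corner has only the partners (0, 1) and (1, 0). With the corner gone the layer falls
  into two separate paths of \<open>n + 1\<close> cells each, hence the cut at
  \<open>n + 1\<close>.\<close>

lemma num_matchings_mK_map:
  assumes "length \<delta> = 2 * n + 3"
  shows "num_matchings dominoes (inner_quadrant (n + 2) \<union> zero_cells (axis_cell (n + 1)) \<delta>) =
    lin_ext (\<lambda>\<eta>. num_matchings dominoes (inner_quadrant (n + 2)
        \<union> zero_cells (left_cell n) (take (n + 1) \<eta>) \<union> zero_cells bottom_cell (drop (n + 1) \<eta>)))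
      (mK_map (n + 1) \<delta>)"
proof -
  have "length \<delta> = n + 3 + n" using assms by simp
  then obtain \<alpha> \<mu> \<beta> where \<delta>: "\<delta> = \<alpha> @ \<mu> @ \<beta>" and len: "length \<alpha> = n" "length \<mu> = 3" "length \<beta> = n"
    by (rule split_middle)
  from len(2) obtain x y z where \<mu>: "\<mu> = [x, y, z]"
    by (auto simp: numeral_eq_Suc length_Suc_conv)
  \<comment> \<open>The index is shifted by one because \<open>bottom_cell 0\<close> is (1, 0),
    which belongs to the middle triple.\<close>
  let ?\<beta> = "zero_cells (\<lambda>k. bottom_cell (Suc k)) \<beta>"
  define Y where "Y = inner_quadrant (n + 2) \<union> zero_cells (left_cell n) \<alpha> \<union> ?\<beta>"
  have finY: "finite Y" by (simp add: Y_def)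
  have Y: "(0, 0) \<notin> Y" "(0, 1) \<notin> Y" "(1, 0) \<notin> Y" "(0, -1) \<notin> Y" "(-1, 0) \<notin> Y"
    using len by (auto simp: Y_def inner_quadrant_def zero_cells_def left_cell_def bottom_cell_def)
  let ?L = "(0, 1) :: int \<times> int" and ?M = "(0, 0) :: int \<times> int" and ?R = "(1, 0) :: int \<times> int"
  have "zero_cells (axis_cell (n + 1)) \<delta>
      = zero_cells (left_cell n) \<alpha> \<union> zero_cell x ?L \<union> zero_cell y ?M \<union> zero_cell z ?R \<union> ?\<beta>"
  proof -
    have "zero_cells (axis_cell (n + 1)) \<alpha> = zero_cells (left_cell n) \<alpha>"
      by (rule zero_cells_cong) (auto simp: len axis_cell_def left_cell_def)
    moreover have "(\<lambda>k. axis_cell (n + 1) (n + Suc (Suc (Suc k)))) = (\<lambda>k. bottom_cell (Suc k))"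
      "axis_cell (n + 1) n = ?L" "axis_cell (n + 1) (n + Suc 0) = ?M" "axis_cell (n + 1) (n + Suc (Suc 0)) = ?R"
      by (auto simp: axis_cell_def bottom_cell_def fun_eq_iff)
    ultimately show ?thesis
      by (simp only: \<delta> \<mu> zero_cells_append zero_cells_Cons zero_cells_Nil len Un_assoc append.simps Un_empty_left add_0_right)
  qed
  then have "num_matchings dominoes (inner_quadrant (n + 2) \<union> zero_cells (axis_cell (n + 1)) \<delta>)
    = num_matchings dominoes (Y \<union> zero_cell x ?L \<union> zero_cell y ?M \<union> zero_cell z ?R)"
    by (simp only: Y_def Un_ac)
  also have "\<dots> = lin_ext (\<lambda>\<gamma>. num_matchings dominoes (Y \<union> zero_cell (\<gamma> ! 0) ?L \<union> zero_cell (\<gamma> ! 1) ?R))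
      (mid_triple [x, y, z])"
    using Y finY by (intro num_matchings_corner) (auto simp: neighbours_def)
  also have "\<dots> = lin_ext (\<lambda>\<gamma>. num_matchings dominoes (inner_quadrant (n + 2)
        \<union> zero_cells (left_cell n) (take (n + 1) (\<alpha> @ \<gamma> @ \<beta>))
        \<union> zero_cells bottom_cell (drop (n + 1) (\<alpha> @ \<gamma> @ \<beta>)))) (mid_triple [x, y, z])"
  proof (rule lin_ext_cong)
    fix \<gamma> assume "\<gamma> \<in> Poly_Mapping.keys (mid_triple [x, y, z])"
    then have "length \<gamma> = 2"
      by (auto simp: mid_triple_def split: if_splits dest!: subsetD[OF Poly_Mapping.keys_add])
    then obtain a b where \<gamma>: "\<gamma> = [a, b]"
      by (auto simp: numeral_eq_Suc length_Suc_conv)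
    have "left_cell n n = ?L" "bottom_cell 0 = ?R"
      by (auto simp: left_cell_def bottom_cell_def)
    then have "Y \<union> zero_cell (\<gamma> ! 0) ?L \<union> zero_cell (\<gamma> ! 1) ?R = inner_quadrant (n + 2)
        \<union> zero_cells (left_cell n) (take (n + 1) (\<alpha> @ \<gamma> @ \<beta>))
        \<union> zero_cells bottom_cell (drop (n + 1) (\<alpha> @ \<gamma> @ \<beta>))"
      by (simp add: \<gamma> len zero_cells_append Y_def)
    then show "num_matchings dominoes (Y \<union> zero_cell (\<gamma> ! 0) ?L \<union> zero_cell (\<gamma> ! 1) ?R)
        = num_matchings dominoes (inner_quadrant (n + 2)
        \<union> zero_cells (left_cell n) (take (n + 1) (\<alpha> @ \<gamma> @ \<beta>))
        \<union> zero_cells bottom_cell (drop (n + 1) (\<alpha> @ \<gamma> @ \<beta>)))"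
      by (rule arg_cong)
  qed
  finally show ?thesis
    by (simp add: mK_map_def lin_ext_frag_extend \<delta> \<mu> len)
qed

lemma keys_mK_map_length:
  assumes "\<eta> \<in> Poly_Mapping.keys (mK_map (n + 1) \<delta>)" "length \<delta> = 2 * n + 3"
  shows "length \<eta> = 2 * n + 2"
proof -
  have "\<eta> \<in> (\<Union>\<gamma>\<in>Poly_Mapping.keys (mid_triple (take 3 (drop n \<delta>))).
      Poly_Mapping.keys (frag_of (take n \<delta> @ \<gamma> @ drop (n + 3) \<delta>)))"
    using assms(1) keys_frag_extend[of "\<lambda>\<gamma>. frag_of (take n \<delta> @ \<gamma> @ drop (n + 3) \<delta>)"
        "mid_triple (take 3 (drop n \<delta>))"]
    by (auto simp: mK_map_def numeral_3_eq_3)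
  then obtain \<gamma> where \<gamma>: "\<gamma> \<in> Poly_Mapping.keys (mid_triple (take 3 (drop n \<delta>)))"
    "\<eta> = take n \<delta> @ \<gamma> @ drop (n + 3) \<delta>" by auto
  from \<gamma>(1) have "length \<gamma> = 2"
    by (auto simp: mid_triple_def split: if_splits dest!: subsetD[OF Poly_Mapping.keys_add])
  with \<gamma>(2) assms(2) show ?thesis by simp
qed

lemma path_edges_left: "path_edges (left_cell n) 1 (n + 1) = {{(0, j), (0, j + 1)} | j. 1 \<le> j \<and> j \<le> int n}"
proof (intro equalityI subsetI)
  fix e assume "e \<in> path_edges (left_cell n) 1 (n + 1)"
  then obtain i where "1 \<le> i" "i \<le> n" and e: "e = {left_cell n (i - 1), left_cell n i}"
    by (auto simp: path_edges_def)
  then show "e \<in> {{(0, j), (0, j + 1)} | j. 1 \<le> j \<and> j \<le> int n}"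
    by (intro CollectI exI[of _ "int n + 1 - int i"]) (auto simp: left_cell_def of_nat_diff)
next
  fix e :: "(int \<times> int) set" assume "e \<in> {{(0, j), (0, j + 1)} | j. 1 \<le> j \<and> j \<le> int n}"
  then obtain j where "1 \<le> j" "j \<le> int n" and e: "e = {(0, j), (0, j + 1)}" by auto
  then show "e \<in> path_edges (left_cell n) 1 (n + 1)"
    unfolding path_edges_def
    by (intro image_eqI[of _ _ "nat (int n + 1 - j)"]) (auto simp: left_cell_def of_nat_diff nat_diff_distrib)
qed

lemma path_edges_bottom: "path_edges bottom_cell 1 (n + 1) = {{(i, 0), (i + 1, 0)} | i. 1 \<le> i \<and> i \<le> int n}"
proof (intro equalityI subsetI)
  fix e assume "e \<in> path_edges bottom_cell 1 (n + 1)"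
  then obtain i where "1 \<le> i" "i \<le> n" and e: "e = {bottom_cell (i - 1), bottom_cell i}"
    by (auto simp: path_edges_def)
  then show "e \<in> {{(i, 0), (i + 1, 0)} | i. 1 \<le> i \<and> i \<le> int n}"
    by (intro CollectI exI[of _ "int i"]) (auto simp: bottom_cell_def of_nat_diff)
next
  fix e :: "(int \<times> int) set" assume "e \<in> {{(i, 0), (i + 1, 0)} | i. 1 \<le> i \<and> i \<le> int n}"
  then obtain i where "1 \<le> i" "i \<le> int n" and e: "e = {(i, 0), (i + 1, 0)}" by auto
  then show "e \<in> path_edges bottom_cell 1 (n + 1)"
    unfolding path_edges_def
    by (intro image_eqI[of _ _ "nat i"]) (auto simp: bottom_cell_def of_nat_diff)
qed

lemma path_edge_nonempty: "e \<in> path_edges c a b \<Longrightarrow> \<exists>x. x \<in> e"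
  by (auto simp: path_edges_def)

lemma left_edge_fst: "e \<in> path_edges (left_cell n) a b \<Longrightarrow> c \<in> e \<Longrightarrow> fst c = 0"
  by (auto simp: path_edges_def left_cell_def)

lemma bottom_edge_snd: "e \<in> path_edges bottom_cell a b \<Longrightarrow> c \<in> e \<Longrightarrow> snd c = 0"
  by (auto simp: path_edges_def bottom_cell_def)

lemma bottom_edge_fst: "e \<in> path_edges bottom_cell a b \<Longrightarrow> c \<in> e \<Longrightarrow> fst c > 0"
  by (auto simp: path_edges_def bottom_cell_def)

text \<open>The dominoes left once the steps \<open>E\<^sup>i\<close> have decided all edges inside the layer.\<close>

definition rungs :: "nat \<Rightarrow> (int \<times> int) set set" where
  "rungs n = dominoes - path_edges (left_cell n) 1 (n + 1) - path_edges bottom_cell 1 (n + 1)"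

text \<open>The path lemma is used twice: for the left arm with the bottom arm counted among the
  other cells, then for the bottom arm in the graph that has already lost the left edges.\<close>

lemma num_matchings_E_tensor_E:
  assumes "length \<eta> = 2 * n + 2"
  shows "num_matchings dominoes (inner_quadrant (n + 2)
        \<union> zero_cells (left_cell n) (take (n + 1) \<eta>) \<union> zero_cells bottom_cell (drop (n + 1) \<eta>))
    = lin_ext (\<lambda>\<zeta>. num_matchings (rungs n) (inner_quadrant (n + 2)
        \<union> zero_cells (left_cell n) (take (n + 1) \<zeta>) \<union> zero_cells bottom_cell (drop (n + 1) \<zeta>)))
      (E_tensor_E (n + 1) \<eta>)"
proof -
  let ?I = "inner_quadrant (n + 2)"
  let ?l = "left_cell n" and ?\<alpha> = "take (n + 1) \<eta>" and ?\<beta> = "drop (n + 1) \<eta>"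
  let ?G = "dominoes - path_edges ?l 1 (n + 1)"
  have len: "length ?\<alpha> = n + 1" "length ?\<beta> = n + 1" using assms by auto
  have inj: "inj ?l" "inj bottom_cell"
    by (auto simp: inj_on_def left_cell_def bottom_cell_def)
  have "num_matchings dominoes (?I \<union> zero_cells ?l ?\<alpha> \<union> zero_cells bottom_cell ?\<beta>)
      = num_matchings dominoes ((?I \<union> zero_cells bottom_cell ?\<beta>) \<union> zero_cells ?l ?\<alpha>)"
    by (simp only: Un_ac)
  also have "\<dots> = lin_ext (\<lambda>\<gamma>. num_matchings ?G ((?I \<union> zero_cells bottom_cell ?\<beta>) \<union> zero_cells ?l \<gamma>))
      (E_map (n + 1) (frag_of ?\<alpha>))"
  proof (rule lin_ext_E_map_matchings[symmetric, OF inj(1)])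
    show "range ?l \<inter> (?I \<union> zero_cells bottom_cell ?\<beta>) = {}"
      by (auto simp: left_cell_def bottom_cell_def inner_quadrant_def zero_cells_def)
    show "path_edges ?l 1 (n + 1) \<subseteq> dominoes"
      unfolding path_edges_left dominoes_def by blast
  qed (use len in auto)
  also have "\<dots> = lin_ext (\<lambda>\<gamma>. lin_ext (\<lambda>\<delta>. num_matchings (rungs n)
        ((?I \<union> zero_cells ?l \<gamma>) \<union> zero_cells bottom_cell \<delta>)) (E_map (n + 1) (frag_of ?\<beta>)))
      (E_map (n + 1) (frag_of ?\<alpha>))"
  proof (rule lin_ext_cong)
    fix \<gamma> assume "\<gamma> \<in> Poly_Mapping.keys (E_map (n + 1) (frag_of ?\<alpha>))"
    have "lin_ext (\<lambda>\<delta>. num_matchings (?G - path_edges bottom_cell 1 (n + 1))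
        ((?I \<union> zero_cells ?l \<gamma>) \<union> zero_cells bottom_cell \<delta>)) (E_map (n + 1) (frag_of ?\<beta>))
      = num_matchings ?G ((?I \<union> zero_cells ?l \<gamma>) \<union> zero_cells bottom_cell ?\<beta>)"
    proof (rule lin_ext_E_map_matchings[OF inj(2)])
      show "range bottom_cell \<inter> (?I \<union> zero_cells ?l \<gamma>) = {}"
        by (auto simp: left_cell_def bottom_cell_def inner_quadrant_def zero_cells_def)
      have "path_edges bottom_cell 1 (n + 1) \<subseteq> dominoes"
        unfolding path_edges_bottom dominoes_def by blast
      \<comment> \<open>A cell of a left edge has first coordinate 0, one of a bottom edge a
        positive one. So deleting the left edges has spared the bottom edges.\<close>
      moreover have "path_edges bottom_cell 1 (n + 1) \<inter> path_edges ?l 1 (n + 1) = {}"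
      proof (rule equals0I)
        fix e assume e: "e \<in> path_edges bottom_cell 1 (n + 1) \<inter> path_edges ?l 1 (n + 1)"
        then obtain c where "c \<in> e" using path_edge_nonempty by blast
        then show False using e bottom_edge_fst[of e _ _ c] left_edge_fst[of e _ _ _ c] by force
      qed
      ultimately show "path_edges bottom_cell 1 (n + 1) \<subseteq> ?G" by blast
    qed (use len in auto)
    then show "num_matchings ?G ((?I \<union> zero_cells bottom_cell ?\<beta>) \<union> zero_cells ?l \<gamma>)
      = lin_ext (\<lambda>\<delta>. num_matchings (rungs n)
        ((?I \<union> zero_cells ?l \<gamma>) \<union> zero_cells bottom_cell \<delta>)) (E_map (n + 1) (frag_of ?\<beta>))"
      unfolding rungs_def by (simp only: Un_ac)
  qed
  \<comment> \<open>Sequences in the support of \<open>E_map\<close> keep their length, so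
    \<open>take\<close> and \<open>drop\<close> recover the two halves.\<close>
  also have "\<dots> = lin_ext (\<lambda>\<gamma>. lin_ext (\<lambda>\<delta>. num_matchings (rungs n) (?I
        \<union> zero_cells ?l (take (n + 1) (\<gamma> @ \<delta>)) \<union> zero_cells bottom_cell (drop (n + 1) (\<gamma> @ \<delta>))))
        (E_map (n + 1) (frag_of ?\<beta>))) (E_map (n + 1) (frag_of ?\<alpha>))"
  proof (intro lin_ext_cong)
    fix \<gamma> \<delta> assume "\<gamma> \<in> Poly_Mapping.keys (E_map (n + 1) (frag_of ?\<alpha>))"
    then have "length \<gamma> = n + 1" using len by (metis keys_E_map_length)
    then show "num_matchings (rungs n) ((?I \<union> zero_cells ?l \<gamma>) \<union> zero_cells bottom_cell \<delta>)
      = num_matchings (rungs n) (?I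
        \<union> zero_cells ?l (take (n + 1) (\<gamma> @ \<delta>)) \<union> zero_cells bottom_cell (drop (n + 1) (\<gamma> @ \<delta>)))"
      by simp
  qed
  finally show ?thesis by (simp only: lin_ext_E_tensor_E)
qed

lemma keys_E_tensor_E_length:
  assumes "\<zeta> \<in> Poly_Mapping.keys (E_tensor_E m \<eta>)"
  shows "length \<zeta> = length \<eta>"
proof -
  let ?a = "E_map m (frag_of (take m \<eta>))" and ?b = "E_map m (frag_of (drop m \<eta>))"
  let ?f = "\<lambda>\<gamma> \<delta>. frag_cmul (Poly_Mapping.lookup ?a \<gamma> * Poly_Mapping.lookup ?b \<delta>) (frag_of (\<gamma> @ \<delta>))"
  have "\<zeta> \<in> (\<Union>\<gamma>\<in>Poly_Mapping.keys ?a. Poly_Mapping.keys (\<Sum>\<delta>\<in>Poly_Mapping.keys ?b. ?f \<gamma> \<delta>))"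
    using assms keys_sum unfolding E_tensor_E_def Let_def by (rule subsetD[rotated])
  then obtain \<gamma> where \<gamma>: "\<gamma> \<in> Poly_Mapping.keys ?a"
    and "\<zeta> \<in> Poly_Mapping.keys (\<Sum>\<delta>\<in>Poly_Mapping.keys ?b. ?f \<gamma> \<delta>)" by (rule UN_E)
  then have "\<zeta> \<in> (\<Union>\<delta>\<in>Poly_Mapping.keys ?b. Poly_Mapping.keys (?f \<gamma> \<delta>))"
    using keys_sum by (rule_tac subsetD)
  then obtain \<delta> where \<delta>: "\<delta> \<in> Poly_Mapping.keys ?b" and "\<zeta> \<in> Poly_Mapping.keys (?f \<gamma> \<delta>)"
    by (rule UN_E)
  then have "\<zeta> = \<gamma> @ \<delta>"
    using keys_cmul[of _ "frag_of (\<gamma> @ \<delta>)"] by fastforce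
  then show ?thesis
    using keys_E_map_length[OF \<gamma>] keys_E_map_length[OF \<delta>] by simp
qed

text \<open>With the edges along its arm deleted, (0, j) can only be matched with (1, j), and (i, 0)
  only with (i, 1); taking the maximum with 1 in both coordinates describes both cases. The only
  cells with a common partner are (0, 1) and (1, 0). Dominoes inside the inner quadrant are not
  affected by the deletion.\<close>

lemma num_matchings_rungs:
  assumes "finite W" "W \<subseteq> {(0, j) | j. 1 \<le> j \<and> j \<le> int n + 1} \<union> {(i, 0) | i. 1 \<le> i \<and> i \<le> int n + 1}"
  shows "num_matchings (rungs n) (inner_quadrant (n + 2) \<union> W) =
    (if (0, 1) \<in> W \<and> (1, 0) \<in> W then 0
     else num_matchings dominoes (inner_quadrant (n + 2) - (\<lambda>(i, j). (max 1 i, max 1 j)) ` W))"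
proof -
  let ?q = "\<lambda>(i::int, j::int). (max 1 i, max 1 j)"
  let ?I = "inner_quadrant (n + 2)"
  have W: "(\<exists>j. w = (0, j) \<and> 1 \<le> j \<and> j \<le> int n + 1) \<or> (\<exists>i. w = (i, 0) \<and> 1 \<le> i \<and> i \<le> int n + 1)"
    if "w \<in> W" for w using that assms(2) by auto
  \<comment> \<open>In particular the corner (0, 0) is absent, so an edge that stays on an axis is
    one of the deleted path edges.\<close>
  have dom: "i \<ge> 0 \<and> j \<ge> 0 \<and> i + j \<le> int n + 2 \<and> (i = 0 \<longrightarrow> 1 \<le> j \<and> j \<le> int n + 1)
      \<and> (j = 0 \<longrightarrow> 1 \<le> i \<and> i \<le> int n + 1)" if "(i, j) \<in> ?I \<union> W" for i j
    using that W[of "(i, j)"] by (auto simp: inner_quadrant_def)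
  have main: "num_matchings (rungs n) (?I \<union> W) =
    (if inj_on ?q W \<and> ?q ` W \<subseteq> ?I then num_matchings (rungs n) (?I - ?q ` W) else 0)"
  proof (rule num_matchings_forced[OF assms(1)])
    show "W \<inter> ?I = {}" "?q ` W \<inter> W = {}"
      using W by (fastforce simp: inner_quadrant_def)+
    fix w e assume w: "w \<in> W" "w \<in> e" and e: "e \<subseteq> ?I \<union> W"
    from W[OF w(1)] show "e \<in> rungs n \<longleftrightarrow> e = {w, ?q w}"
    proof (elim disjE exE conjE)
      fix j assume wj: "w = (0, j)" "1 \<le> j" "j \<le> int n + 1"
      show ?thesis
      proof
        assume r: "e \<in> rungs n"
        then obtain d where d: "d \<in> neighbours w" "e = {w, d}"
          using domino_iff_neighbours[OF w(2)] by (auto simp: rungs_def)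
        then consider "d = (1, j)" | "d = (-1, j)" | "d = (0, j + 1)" | "d = (0, j - 1)"
          by (auto simp: neighbours_def wj)
        then show "e = {w, ?q w}"
        proof cases
          case 1
          then show ?thesis using d wj by simp
        next
          case 2
          then show ?thesis using d e dom[of "-1" j] by simp
        next
          case 3
          then have "e \<in> path_edges (left_cell n) 1 (n + 1)"
            unfolding path_edges_left using d e dom[of 0 "j + 1"] wj by auto
          then show ?thesis using r by (simp add: rungs_def)
        next
          case 4
          then have "e \<in> path_edges (left_cell n) 1 (n + 1)"
            unfolding path_edges_left using d e dom[of 0 "j - 1"] wj
            by (intro CollectI exI[of _ "j - 1"]) auto
          then show ?thesis using r by (simp add: rungs_def)
        qed
      next
        assume "e = {w, ?q w}"
        then have e': "e = {(0, j), (1, j)}" using wj by simp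
        have "e \<in> dominoes"
          using domino_iff_neighbours[OF w(2)] e' wj by (auto simp: neighbours_def)
        moreover have "e \<notin> path_edges (left_cell n) 1 (n + 1)"
          using e' wj left_edge_fst[of e n 1 "n + 1" "(1, j)"] by auto
        moreover have "e \<notin> path_edges bottom_cell 1 (n + 1)"
          using e' wj bottom_edge_snd[of e 1 "n + 1" "(1, j)"] by auto
        ultimately show "e \<in> rungs n" by (simp add: rungs_def)
      qed
    next
      fix i assume wi: "w = (i, 0)" "1 \<le> i" "i \<le> int n + 1"
      show ?thesis
      proof
        assume r: "e \<in> rungs n"
        then obtain d where d: "d \<in> neighbours w" "e = {w, d}"
          using domino_iff_neighbours[OF w(2)] by (auto simp: rungs_def)
        then consider "d = (i, 1)" | "d = (i, -1)" | "d = (i + 1, 0)" | "d = (i - 1, 0)"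
          by (auto simp: neighbours_def wi)
        then show "e = {w, ?q w}"
        proof cases
          case 1
          then show ?thesis using d wi by simp
        next
          case 2
          then show ?thesis using d e dom[of i "-1"] by simp
        next
          case 3
          then have "e \<in> path_edges bottom_cell 1 (n + 1)"
            unfolding path_edges_bottom using d e dom[of "i + 1" 0] wi by auto
          then show ?thesis using r by (simp add: rungs_def)
        next
          case 4
          then have "e \<in> path_edges bottom_cell 1 (n + 1)"
            unfolding path_edges_bottom using d e dom[of "i - 1" 0] wi
            by (intro CollectI exI[of _ "i - 1"]) auto
          then show ?thesis using r by (simp add: rungs_def)
        qed
      next
        assume "e = {w, ?q w}"
        then have e': "e = {(i, 0), (i, 1)}" using wi by simp
        have "e \<in> dominoes"
          using domino_iff_neighbours[OF w(2)] e' wi by (auto simp: neighbours_def)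
        moreover have "e \<notin> path_edges (left_cell n) 1 (n + 1)"
          using e' wi left_edge_fst[of e n 1 "n + 1" "(i, 1)"] by auto
        moreover have "e \<notin> path_edges bottom_cell 1 (n + 1)"
          using e' wi bottom_edge_snd[of e 1 "n + 1" "(i, 1)"] by auto
        ultimately show "e \<in> rungs n" by (simp add: rungs_def)
      qed
    qed
  qed simp
  have "?q ` W \<subseteq> ?I"
    using W by (fastforce simp: inner_quadrant_def)
  moreover have "inj_on ?q W \<longleftrightarrow> \<not> ((0, 1) \<in> W \<and> (1, 0) \<in> W)"
  proof
    assume "inj_on ?q W"
    then show "\<not> ((0, 1) \<in> W \<and> (1, 0) \<in> W)"
      using inj_onD[of ?q W "(0, 1)" "(1, 0)"] by auto
  next
    assume corner: "\<not> ((0, 1) \<in> W \<and> (1, 0) \<in> W)"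
    show "inj_on ?q W"
    proof (rule inj_onI)
      fix v w assume vw: "v \<in> W" "w \<in> W" "?q v = ?q w"
      from W[OF vw(1)] W[OF vw(2)] vw corner show "v = w" by auto
    qed
  qed
  moreover have "num_matchings (rungs n) (?I - ?q ` W) = num_matchings dominoes (?I - ?q ` W)"
  proof (rule num_matchings_cong)
    fix e assume "e \<subseteq> ?I - ?q ` W"
    then have e: "fst c \<ge> 1 \<and> snd c \<ge> 1" if "c \<in> e" for c
      using that by (auto simp: inner_quadrant_def)
    have "e \<notin> path_edges (left_cell n) 1 (n + 1)"
      using e left_edge_fst path_edge_nonempty by fastforce
    moreover have "e \<notin> path_edges bottom_cell 1 (n + 1)"
      using e bottom_edge_snd path_edge_nonempty by fastforce
    ultimately show "e \<in> rungs n \<longleftrightarrow> e \<in> dominoes" by (simp add: rungs_def)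
  qed
  ultimately show ?thesis using main by auto
qed

text \<open>A cell of the translated quadrant's axis is gone exactly if it is the partner of a
  present cell. On the arms this exchanges 0 and 1. The middle cell is gone if either of its two
  possible partners is present, and \<open>central_pair\<close> gives 1 in just that case.\<close>

lemma num_matchings_cK_map:
  assumes "length \<zeta> = 2 * n + 2"
  shows "num_matchings (rungs n) (inner_quadrant (n + 2)
        \<union> zero_cells (left_cell n) (take (n + 1) \<zeta>) \<union> zero_cells bottom_cell (drop (n + 1) \<zeta>))
    = lin_ext (\<lambda>\<theta>. lin_ext (\<lambda>\<epsilon>. num_matchings dominoes (region n \<epsilon>)) (R_id_R n \<theta>)) (cK_map (n + 1) \<zeta>)"
proof -
  have "length \<zeta> = n + 2 + n" using assms by simp
  then obtain \<alpha> \<mu> \<beta> where \<zeta>: "\<zeta> = \<alpha> @ \<mu> @ \<beta>" and len: "length \<alpha> = n" "length \<mu> = 2" "length \<beta> = n"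
    by (rule split_middle)
  from len(2) obtain x y where \<mu>: "\<mu> = [x, y]"
    by (auto simp: numeral_eq_Suc length_Suc_conv)
  let ?q = "\<lambda>(i::int, j::int). (max 1 i, max 1 j)"
  let ?s = "\<lambda>(i::int, j::int). (i + 1, j + 1)"
  let ?c = "\<lambda>k. ?s (axis_cell n k)"
  let ?I = "inner_quadrant (n + 2)"
  define W where "W = zero_cells (left_cell n) (\<alpha> @ [x]) \<union> zero_cells bottom_cell (y # \<beta>)"
  have split: "take (n + 1) \<zeta> = \<alpha> @ [x]" "drop (n + 1) \<zeta> = y # \<beta>"
    using len by (auto simp: \<zeta> \<mu>)
  have corner: "(0, 1) \<in> W \<longleftrightarrow> x = 0" "(1, 0) \<in> W \<longleftrightarrow> y = 0"
    using len by (auto simp: W_def zero_cells_def left_cell_def bottom_cell_def nth_append)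
  have Wsub: "W \<subseteq> {(0, j) | j. 1 \<le> j \<and> j \<le> int n + 1} \<union> {(i, 0) | i. 1 \<le> i \<and> i \<le> int n + 1}"
    using len by (auto simp: W_def zero_cells_def left_cell_def bottom_cell_def)
  have "num_matchings (rungs n) (?I \<union> zero_cells (left_cell n) (take (n + 1) \<zeta>)
        \<union> zero_cells bottom_cell (drop (n + 1) \<zeta>))
      = num_matchings (rungs n) (?I \<union> W)"
    unfolding split W_def by (simp only: Un_assoc)
  also have "\<dots> = (if x = 0 \<and> y = 0 then 0 else num_matchings dominoes (?I - ?q ` W))"
    using num_matchings_rungs[OF _ Wsub] corner by (simp add: W_def)
  finally have lhs: "num_matchings (rungs n) (?I \<union> zero_cells (left_cell n) (take (n + 1) \<zeta>)
        \<union> zero_cells bottom_cell (drop (n + 1) \<zeta>))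
      = (if x = 0 \<and> y = 0 then 0 else num_matchings dominoes (?I - ?q ` W))" .
  \<comment> \<open>The last cell of the left arm and the first of the bottom arm have the same
    partner, the translated corner, so their two entries become one.\<close>
  have qW: "?q ` W = zero_cells ?c (\<alpha> @ [if x = 0 \<or> y = 0 then 0 else 1] @ \<beta>)"
  proof -
    have "zero_cells (\<lambda>k. ?q (left_cell n k)) \<alpha> = zero_cells ?c \<alpha>"
      by (rule zero_cells_cong) (auto simp: len left_cell_def axis_cell_def)
    moreover have "(\<lambda>k. ?q (bottom_cell (Suc k))) = (\<lambda>k. ?c (n + Suc k))"
      by (auto simp: bottom_cell_def axis_cell_def fun_eq_iff)
    moreover have "?q (left_cell n n) = ?c n" "?q (bottom_cell 0) = ?c n"
      by (auto simp: left_cell_def bottom_cell_def axis_cell_def)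
    ultimately show ?thesis
      by (simp only: W_def image_Un image_zero_cells zero_cells_append zero_cells_Cons zero_cells_Nil len
          Un_empty_right add_0_right append.simps) auto
  qed
  \<comment> \<open>The complements here undo \<open>R_seq\<close> in the definition of
    \<open>region\<close>, so the removed cells are selected by the zeros of the original
    arms.\<close>
  have shift: "num_matchings dominoes (region n (R_seq \<alpha> @ [z] @ R_seq \<beta>))
      = num_matchings dominoes (?I - zero_cells ?c (\<alpha> @ [1 - z] @ \<beta>))" for z
  proof -
    have "R_seq [z] = [1 - z]" by (simp add: R_seq_def)
    moreover have "?s ` quadrant n = ?I"
    proof (intro equalityI subsetI)
      fix c assume "c \<in> ?I"
      then show "c \<in> ?s ` quadrant n"
        by (intro image_eqI[of _ _ "(fst c - 1, snd c - 1)"]) (auto simp: inner_quadrant_def quadrant_def)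
    qed (auto simp: inner_quadrant_def quadrant_def)
    moreover have "inj ?s" by (auto simp: inj_on_def)
    ultimately have "?s ` region n (R_seq \<alpha> @ [z] @ R_seq \<beta>) = ?I - zero_cells ?c (\<alpha> @ [1 - z] @ \<beta>)"
      by (simp only: region_def image_set_diff image_zero_cells R_seq_append R_seq_R_seq)
    then show ?thesis
      using num_matchings_dominoes_shift[of 1 1 "region n (R_seq \<alpha> @ [z] @ R_seq \<beta>)"] by simp
  qed
  have "R_id_R n (\<alpha> @ [z] @ \<beta>) = frag_of (R_seq \<alpha> @ [z] @ R_seq \<beta>)" for z
    using len by (simp add: R_id_R_def nth_append)
  then have "lin_ext (\<lambda>\<theta>. lin_ext (\<lambda>\<epsilon>. num_matchings dominoes (region n \<epsilon>)) (R_id_R n \<theta>)) (frag_of (\<alpha> @ [z] @ \<beta>))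
     = num_matchings dominoes (?I - zero_cells ?c (\<alpha> @ [1 - z] @ \<beta>))" for z
    by (simp only: lin_ext_frag_of shift)
  moreover have "cK_map (n + 1) \<zeta> = (if x = 0 \<and> y = 0 then 0 else frag_of (\<alpha> @ [if x = 0 \<or> y = 0 then 1 else 0] @ \<beta>))"
    using len by (cases "x = 0"; cases "y = 0") (simp_all add: cK_map_def \<zeta> \<mu> central_pair_def)
  ultimately show ?thesis
    unfolding lhs qW by simp
qed

text \<open>Chains the equations of the single maps. Each of them holds only for sequences of the
  right length, so the supports are controlled between the steps.\<close>

lemma num_matchings_region_step:
  assumes "length \<epsilon> = 2 * n + 5"
  shows "num_matchings dominoes (region (n + 2) \<epsilon>) =
    lin_ext (\<lambda>\<epsilon>. num_matchings dominoes (region n \<epsilon>))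
      (frag_extend (R_id_R n) (frag_extend (cK_map (n + 1)) (frag_extend (E_tensor_E (n + 1))
        (frag_extend (mK_map (n + 1)) (K_map (2 * n + 5) \<epsilon>)))))"
proof -
  have "region (n + 2) \<epsilon> = inner_quadrant (n + 2) \<union> zero_cells (axis_cell (n + 2)) \<epsilon>"
    using assms by (intro region_eq) simp
  then have "num_matchings dominoes (region (n + 2) \<epsilon>) =
      lin_ext (\<lambda>\<delta>. num_matchings dominoes (inner_quadrant (n + 2) \<union> zero_cells (axis_cell (n + 1)) \<delta>))
        (K_map (2 * n + 5) \<epsilon>)"
    using num_matchings_K_map[OF assms] by simp
  also have "\<dots> = lin_ext (\<lambda>\<delta>. lin_ext (\<lambda>\<eta>. lin_ext (\<lambda>\<zeta>.
      lin_ext (\<lambda>\<theta>. lin_ext (\<lambda>\<epsilon>. num_matchings dominoes (region n \<epsilon>)) (R_id_R n \<theta>))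
        (cK_map (n + 1) \<zeta>)) (E_tensor_E (n + 1) \<eta>)) (mK_map (n + 1) \<delta>)) (K_map (2 * n + 5) \<epsilon>)"
  proof (rule lin_ext_cong)
    fix \<delta> assume "\<delta> \<in> Poly_Mapping.keys (K_map (2 * n + 5) \<epsilon>)"
    then have \<delta>: "length \<delta> = 2 * n + 3" using assms by (rule keys_K_map_length)
    show "num_matchings dominoes (inner_quadrant (n + 2) \<union> zero_cells (axis_cell (n + 1)) \<delta>) =
      lin_ext (\<lambda>\<eta>. lin_ext (\<lambda>\<zeta>.
        lin_ext (\<lambda>\<theta>. lin_ext (\<lambda>\<epsilon>. num_matchings dominoes (region n \<epsilon>)) (R_id_R n \<theta>))
          (cK_map (n + 1) \<zeta>)) (E_tensor_E (n + 1) \<eta>)) (mK_map (n + 1) \<delta>)"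
      unfolding num_matchings_mK_map[OF \<delta>]
    proof (rule lin_ext_cong)
      fix \<eta> assume "\<eta> \<in> Poly_Mapping.keys (mK_map (n + 1) \<delta>)"
      then have \<eta>: "length \<eta> = 2 * n + 2" using \<delta> by (rule keys_mK_map_length)
      show "num_matchings dominoes (inner_quadrant (n + 2)
          \<union> zero_cells (left_cell n) (take (n + 1) \<eta>) \<union> zero_cells bottom_cell (drop (n + 1) \<eta>)) =
        lin_ext (\<lambda>\<zeta>.
          lin_ext (\<lambda>\<theta>. lin_ext (\<lambda>\<epsilon>. num_matchings dominoes (region n \<epsilon>)) (R_id_R n \<theta>))
            (cK_map (n + 1) \<zeta>)) (E_tensor_E (n + 1) \<eta>)"
        unfolding num_matchings_E_tensor_E[OF \<eta>]
        by (intro lin_ext_cong num_matchings_cK_map) (use \<eta> keys_E_tensor_E_length in auto)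
    qed
  qed
  finally show ?thesis
    by (simp only: lin_ext_frag_extend)
qed

section \<open>Lengths in the supports, initial values and the induction for
  \<open>C'\<close>\<close>

lemma keys_frag_extend_all:
  assumes "\<forall>x\<in>Poly_Mapping.keys v. P x" "\<And>x y. P x \<Longrightarrow> y \<in> Poly_Mapping.keys (f x) \<Longrightarrow> Q y"
  shows "\<forall>y\<in>Poly_Mapping.keys (frag_extend f v). Q y"
  using assms keys_frag_extend[of f v] by blast

lemma keys_cK_map_length:
  assumes "\<theta> \<in> Poly_Mapping.keys (cK_map (n + 1) \<zeta>)" "length \<zeta> = 2 * n + 2"
  shows "length \<theta> = 2 * n + 1"
proof -
  have "\<forall>\<theta>\<in>Poly_Mapping.keys (cK_map (n + 1) \<zeta>). length \<theta> = 2 * n + 1"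
    unfolding cK_map_def
  proof (rule keys_frag_extend_all)
    show "\<forall>\<gamma>\<in>Poly_Mapping.keys (central_pair (take 2 (drop (n + 1 - 1) \<zeta>))). length \<gamma> = 1"
      by (auto simp: central_pair_def)
  qed (use assms(2) in auto)
  with assms(1) show ?thesis by blast
qed

text \<open>\<open>C'\<close> is compared with matchings on sequences of full length only, so the
  induction hypothesis needs this for every term of the formal sum.\<close>

lemma keys_transfer_length:
  assumes "length \<epsilon> = 2 * n + 5"
  shows "\<forall>x\<in>Poly_Mapping.keys (frag_extend (R_id_R n) (frag_extend (cK_map (n + 1))
    (frag_extend (E_tensor_E (n + 1)) (frag_extend (mK_map (n + 1)) (K_map (2 * n + 5) \<epsilon>))))).
    length x = 2 * n + 1"
proof (rule keys_frag_extend_all, rule keys_frag_extend_all, rule keys_frag_extend_all, rule keys_frag_extend_all)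
  show "\<forall>x\<in>Poly_Mapping.keys (K_map (2 * n + 5) \<epsilon>). length x = 2 * n + 3"
    using assms keys_K_map_length by blast
  show "length y = 2 * n + 2"
    if "length x = 2 * n + 3" "y \<in> Poly_Mapping.keys (mK_map (n + 1) x)" for x y
    using that(2,1) by (rule keys_mK_map_length)
  show "length y = 2 * n + 2"
    if "length x = 2 * n + 2" "y \<in> Poly_Mapping.keys (E_tensor_E (n + 1) x)" for x y
    using keys_E_tensor_E_length[OF that(2)] that(1) by simp
  show "length y = 2 * n + 1"
    if "length x = 2 * n + 2" "y \<in> Poly_Mapping.keys (cK_map (n + 1) x)" for x y
    using that(2,1) by (rule keys_cK_map_length)
  show "length y = 2 * n + 1"
    if "length x = 2 * n + 1" "y \<in> Poly_Mapping.keys (R_id_R n x)" for x y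
    using that by (auto simp: R_id_R_def)
qed

text \<open>A rewrite rule for explicit sets: each use takes away one cell and its partner, so the
  counts for the initial values can be evaluated by simplification.\<close>

lemma num_matchings_dominoes_insert:
  assumes "finite S" "(i, j) \<notin> S"
  shows "num_matchings dominoes (insert (i, j) S) =
    (if (i + 1, j) \<in> S then num_matchings dominoes (S - {(i + 1, j)}) else 0)
    + (if (i - 1, j) \<in> S then num_matchings dominoes (S - {(i - 1, j)}) else 0)
    + (if (i, j + 1) \<in> S then num_matchings dominoes (S - {(i, j + 1)}) else 0)
    + (if (i, j - 1) \<in> S then num_matchings dominoes (S - {(i, j - 1)}) else 0)"
proof -
  let ?N = "neighbours (i, j)"
  have "num_matchings dominoes (insert (i, j) S)
      = (\<Sum>d\<in>insert (i, j) S \<inter> ?N. num_matchings dominoes (insert (i, j) S - {(i, j), d}))"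
    using assms(1) by (intro num_matchings_dominoes) auto
  also have "\<dots> = (\<Sum>d\<in>?N \<inter> S. num_matchings dominoes (S - {d}))"
  proof (rule sum.cong)
    show "insert (i, j) S \<inter> ?N = ?N \<inter> S"
      by (auto simp: neighbours_def)
    have "insert (i, j) S - {(i, j), d} = S - {d}" for d
      using assms(2) by auto
    then show "\<And>d. num_matchings dominoes (insert (i, j) S - {(i, j), d}) = num_matchings dominoes (S - {d})"
      by simp
  qed
  also have "\<dots> = (\<Sum>d\<in>?N. if d \<in> S then num_matchings dominoes (S - {d}) else 0)"
    by (rule sum.inter_restrict) (simp add: neighbours_def)
  finally show ?thesis by (simp add: neighbours_def)
qed

lemma C'_eq_num_matchings_1:
  assumes "length \<epsilon> = 3"
  shows "C' 1 \<epsilon> = num_matchings dominoes (region 1 \<epsilon>)"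
proof -
  obtain a b c where \<epsilon>: "\<epsilon> = [a, b, c]"
    using assms by (auto simp: numeral_eq_Suc length_Suc_conv)
  have "inner_quadrant 1 = {}" by (auto simp: inner_quadrant_def)
  then have "region 1 \<epsilon> = zero_cell a (0, 1) \<union> zero_cell b (0, 0) \<union> zero_cell c (1, 0)"
    using region_eq[of \<epsilon> 1] by (simp add: \<epsilon> axis_cell_def Un_assoc)
  then show ?thesis
    by (cases a; cases b; cases c) (simp_all add: \<epsilon> num_matchings_dominoes_insert num_matchings_empty insert_Diff_if)
qed

text \<open>The value 2 belongs to 10001, where the cells left form a 2 by 2 square with its two
  tilings.\<close>

lemma C'_eq_num_matchings_2:
  assumes "length \<epsilon> = 5"
  shows "C' 2 \<epsilon> = num_matchings dominoes (region 2 \<epsilon>)"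
proof -
  obtain a b c d e where \<epsilon>: "\<epsilon> = [a, b, c, d, e]"
    using assms by (auto simp: numeral_eq_Suc length_Suc_conv)
  have "inner_quadrant 2 = {(1, 1)}" by (auto simp: inner_quadrant_def)
  then have "region 2 \<epsilon> = {(1, 1)} \<union> zero_cell a (0, 2) \<union> zero_cell b (0, 1) \<union> zero_cell c (0, 0)
      \<union> zero_cell d (1, 0) \<union> zero_cell e (2, 0)"
    using region_eq[of \<epsilon> 2] by (simp add: \<epsilon> axis_cell_def Un_assoc)
  then show ?thesis
    by (cases a; cases b; cases c; cases d; cases e)
      (simp_all add: \<epsilon> numeral_2_eq_2 num_matchings_dominoes_insert num_matchings_empty insert_Diff_if)
qed

lemma C'_eq_num_matchings:
  assumes "n \<ge> 1" "length \<epsilon> = 2 * n + 1"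
  shows "C' n \<epsilon> = num_matchings dominoes (region n \<epsilon>)"
  using assms
proof (induction n arbitrary: \<epsilon> rule: less_induct)
  case (less n)
  consider "n = 1" | "n = 2" | k where "n = Suc (Suc (Suc k))"
    using less.prems(1) by (cases n rule: C'.cases) auto
  then show ?case
  proof cases
    case 1
    then show ?thesis using less.prems C'_eq_num_matchings_1 by simp
  next
    case 2
    then show ?thesis using less.prems C'_eq_num_matchings_2 by simp
  next
    case (3 k)
    let ?m = "Suc k"
    let ?v = "frag_extend (R_id_R ?m) (frag_extend (cK_map (?m + 1))
      (frag_extend (E_tensor_E (?m + 1)) (frag_extend (mK_map (?m + 1)) (K_map (2 * ?m + 5) \<epsilon>))))"
    have len: "length \<epsilon> = 2 * ?m + 5" using less.prems(2) 3 by simp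
    have "C' n \<epsilon> = lin_ext (C' ?m) ?v"
      unfolding 3 C'.simps Let_def o_def ..
    also have "\<dots> = lin_ext (\<lambda>\<epsilon>. num_matchings dominoes (region ?m \<epsilon>)) ?v"
    proof (rule lin_ext_cong)
      fix \<delta> assume "\<delta> \<in> Poly_Mapping.keys ?v"
      with keys_transfer_length[OF len] have "length \<delta> = 2 * ?m + 1" by blast
      then show "C' ?m \<delta> = num_matchings dominoes (region ?m \<delta>)"
        using 3 by (intro less.IH) auto
    qed
    also have "\<dots> = num_matchings dominoes (region (?m + 2) \<epsilon>)"
      by (rule num_matchings_region_step[OF len, symmetric])
    finally show ?thesis using 3 by simp
  qed
qed

section \<open>Symmetric matchings of the diamond\<close>

text \<open>A cell is named by its lower left vertex, so \<open>x \<mapsto> - x\<close> acts on cells by \<open>i \<mapsto> - 1 - i\<close>.\<close>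

definition flip :: "bool \<Rightarrow> int \<Rightarrow> int" where
  "flip b i = (if b then - 1 - i else i)"

text \<open>The Klein four-group generated by the two axis reflections. The booleans say which
  coordinates are reflected, and composition is exclusive or.\<close>

definition symm :: "bool \<Rightarrow> bool \<Rightarrow> int \<times> int \<Rightarrow> int \<times> int" where
  "symm a b = (\<lambda>(i, j). (flip a i, flip b j))"

text \<open>The nonnegative one of the two coordinates exchanged by
  \<open>flip True\<close>.\<close>

definition fold_int :: "int \<Rightarrow> int" where
  "fold_int i = max i (- 1 - i)"

definition diamond :: "nat \<Rightarrow> (int \<times> int) set" where
  "diamond n = {(i, j). fold_int i + fold_int j \<le> int n}"

definition sym_matchings :: "nat \<Rightarrow> (int \<times> int) set set set" where
  "sym_matchings n = {P \<in> matchings dominoes (diamond n).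
     (`) (symm True False) ` P = P \<and> (`) (symm True True) ` P = P}"

definition cross_left :: "int \<Rightarrow> (int \<times> int) set" where
  "cross_left j = {(- 1, j), (0, j)}"

definition cross_bottom :: "int \<Rightarrow> (int \<times> int) set" where
  "cross_bottom i = {(i, - 1), (i, 0)}"

definition crossings :: "nat \<Rightarrow> (int \<times> int) set set" where
  "crossings n = cross_left ` {0..int n} \<union> cross_bottom ` {0..int n}"

text \<open>Among the crossings, only the two through the corner cell overlap, so this is the
  condition for pairwise disjointness.\<close>

definition crossing_sets :: "nat \<Rightarrow> (int \<times> int) set set set" where
  "crossing_sets n = {B. B \<subseteq> crossings n \<and> \<not> (cross_left 0 \<in> B \<and> cross_bottom 0 \<in> B)}"

definition orbit_union :: "(int \<times> int) set set \<Rightarrow> (int \<times> int) set set" where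
  "orbit_union X = (\<Union>a. \<Union>b. (`) (symm a b) ` X)"

lemma flip_flip: "flip a (flip a' i) = flip (a \<noteq> a') i"
  by (auto simp: flip_def)

lemma sym_sym: "symm a b (symm a' b' c) = symm (a \<noteq> a') (b \<noteq> b') c"
  by (auto simp: symm_def flip_flip split: prod.splits)

lemma sym_False [simp]: "symm False False = id"
  by (auto simp: symm_def flip_def fun_eq_iff)

lemma sym_involution: "symm a b (symm a b c) = c"
  by (simp add: sym_sym)

lemma image_sym_sym: "symm a b ` symm a' b' ` e = symm (a \<noteq> a') (b \<noteq> b') ` e"
  by (simp add: image_image sym_sym)

lemma image_image_sym_sym:
  "(`) (symm a b) ` (`) (symm a' b') ` P = (`) (symm (a \<noteq> a') (b \<noteq> b')) ` P"
  by (simp add: image_image sym_sym)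

lemma sym_in_diamond [simp]: "symm a b c \<in> diamond n \<longleftrightarrow> c \<in> diamond n"
  by (auto simp: symm_def diamond_def fold_int_def flip_def split: prod.splits)

lemma sym_domino:
  assumes "e \<in> dominoes"
  shows "symm a b ` e \<in> dominoes"
proof -
  obtain v where v: "v \<in> e" using assms empty_notin_dominoes by (metis ex_in_conv)
  then obtain d where "d \<in> neighbours v" "e = {v, d}"
    using domino_iff_neighbours assms by blast
  then have "symm a b ` e = {symm a b v, symm a b d}" "symm a b d \<in> neighbours (symm a b v)"
    by (auto simp: neighbours_def symm_def flip_def split: prod.splits)
  then show ?thesis
    using domino_iff_neighbours[of "symm a b v" "symm a b ` e"] by blast
qed

lemma sym_matchings_invariant:
  assumes "P \<in> sym_matchings n"
  shows "(`) (symm a b) ` P = P"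
proof -
  have 1: "(`) (symm True False) ` P = P" "(`) (symm True True) ` P = P"
    using assms by (auto simp: sym_matchings_def)
  then have "(`) (symm True False) ` (`) (symm True True) ` P = P" by simp
  then have "(`) (symm False True) ` P = P" by (simp only: image_image_sym_sym) simp
  with 1 show ?thesis by (cases a; cases b) simp_all
qed

lemma sym_matchings_closed: "P \<in> sym_matchings n \<Longrightarrow> e \<in> P \<Longrightarrow> symm a b ` e \<in> P"
  using sym_matchings_invariant by blast

lemma quadrant_subset_diamond: "quadrant n \<subseteq> diamond n"
  by (auto simp: quadrant_def diamond_def fold_int_def)

lemma diamond_sym_quadrant:
  assumes "c \<in> diamond n"
  obtains a b where "symm a b c \<in> quadrant n"
proof
  show "symm (fst c < 0) (snd c < 0) c \<in> quadrant n"
    using assms by (auto simp: diamond_def quadrant_def symm_def flip_def fold_int_def)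
qed

text \<open>\<open>flip True\<close> exchanges nonnegative and negative integers. So the quadrant is
  a strict fundamental domain for the cells and no cell is fixed by a nontrivial symmetry; only
  crossing dominoes can be.\<close>

lemma sym_quadrant_unique:
  assumes "c \<in> quadrant n" "d \<in> quadrant m" "symm a b c = symm a' b' d"
  shows "c = d" "a = a'" "b = b'"
  using assms by (auto simp: quadrant_def symm_def flip_def split: if_splits)

text \<open>A step outwards from the quadrant past the bound on i + j also leaves the diamond, so a
  domino of the diamond can leave the quadrant only across an axis.\<close>

lemma domino_meets_quadrant:
  assumes "e \<in> dominoes" "e \<subseteq> diamond n" "e \<inter> quadrant n \<noteq> {}"
  shows "e \<subseteq> quadrant n \<or> e \<in> crossings n"
proof -
  obtain i j where v: "(i, j) \<in> e" "(i, j) \<in> quadrant n" using assms(3) by auto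
  then have ij: "0 \<le> i" "0 \<le> j" "i + j \<le> int n" by (auto simp: quadrant_def)
  obtain d where d: "d \<in> neighbours (i, j)" "e = {(i, j), d}"
    using assms(1) domino_iff_neighbours[OF v(1)] by blast
  have dd: "d \<in> diamond n" using d assms(2) by auto
  show ?thesis
  proof (cases "d \<in> quadrant n")
    case True
    then show ?thesis using d v by auto
  next
    case False
    with dd d(1) ij have "i = 0 \<and> d = (-1, j) \<or> j = 0 \<and> d = (i, -1)"
      by (auto simp: neighbours_def quadrant_def diamond_def fold_int_def)
    then have "e = cross_left j \<or> e = cross_bottom i"
      using d(2) by (auto simp: cross_left_def cross_bottom_def)
    with ij show ?thesis by (auto simp: crossings_def)
  qed
qed

lemma crossing_dominoes: "crossings n \<subseteq> dominoes"
proof -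
  have "cross_left j \<in> dominoes" "cross_bottom j \<in> dominoes" for j
    using domino_iff_neighbours[of "(0, j)" "cross_left j"] domino_iff_neighbours[of "(j, 0)" "cross_bottom j"]
    by (auto simp: cross_left_def cross_bottom_def neighbours_def)
  then show ?thesis by (auto simp: crossings_def)
qed

lemma crossing_subset_diamond: "e \<in> crossings n \<Longrightarrow> e \<subseteq> diamond n"
  by (auto simp: crossings_def cross_left_def cross_bottom_def diamond_def fold_int_def)

lemma crossing_not_subset_quadrant: "e \<in> crossings n \<Longrightarrow> \<not> e \<subseteq> quadrant m"
  by (auto simp: crossings_def cross_left_def cross_bottom_def quadrant_def)

text \<open>The two cells of a crossing are mirror images of each other, so folding either of them
  into the quadrant stays within the crossing.\<close>

lemma crossing_trace:
  assumes "e \<in> crossings n" "c \<in> e" "symm a b d = c" "d \<in> quadrant m"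
  shows "d \<in> e"
  using assms
  by (auto simp: crossings_def cross_left_def cross_bottom_def quadrant_def symm_def flip_def split: if_splits)

lemma sym_crossing_in_crossings:
  assumes "e \<in> crossings n" "symm a b ` e \<in> crossings m"
  shows "symm a b ` e = e"
  using assms
  by (auto simp: crossings_def cross_left_def cross_bottom_def symm_def flip_def doubleton_eq_iff split: if_splits)

lemma sym_crossing_meet:
  assumes "e \<in> crossings n" "c \<in> symm a b ` e" "c \<in> symm a' b' ` e"
  shows "symm a b ` e = symm a' b' ` e"
  using assms
  by (auto simp: crossings_def cross_left_def cross_bottom_def symm_def flip_def doubleton_eq_iff split: if_splits)

lemma crossing_sets_disjoint:
  assumes "B \<in> crossing_sets n" "e \<in> B" "e' \<in> B" "c \<in> e" "c \<in> e'" "c \<in> quadrant m"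
  shows "e = e'"
proof -
  have "e \<in> crossings n" "e' \<in> crossings n" using assms by (auto simp: crossing_sets_def)
  then show ?thesis
    using assms by (auto simp: crossings_def crossing_sets_def cross_left_def cross_bottom_def quadrant_def)
qed

lemma orbit_union_iff: "e \<in> orbit_union X \<longleftrightarrow> (\<exists>a b. \<exists>x\<in>X. e = symm a b ` x)"
  by (auto simp: orbit_union_def)

lemma sym_matching_split:
  assumes P: "P \<in> sym_matchings n"
  shows "P \<inter> crossings n \<in> crossing_sets n"
    and "{e \<in> P. e \<subseteq> quadrant n} \<in> matchings dominoes (quadrant n - \<Union>(P \<inter> crossings n))"
proof -
  have P': "P \<subseteq> dominoes" "disjoint P" "\<Union>P = diamond n"
    using P by (auto simp: sym_matchings_def matchings_def)
  have unique: "e = e'" if "e \<in> P" "e' \<in> P" "c \<in> e" "c \<in> e'" for e e' c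
    using that P'(2) by (auto simp: disjoint_def)
  have "(0, 0) \<in> cross_left 0" "(0, 0) \<in> cross_bottom 0" "cross_left 0 \<noteq> cross_bottom 0"
    by (auto simp: cross_left_def cross_bottom_def doubleton_eq_iff)
  then show "P \<inter> crossings n \<in> crossing_sets n"
    using unique[of "cross_left 0" "cross_bottom 0" "(0, 0)"] by (auto simp: crossing_sets_def)
  have "\<Union>{e \<in> P. e \<subseteq> quadrant n} = quadrant n - \<Union>(P \<inter> crossings n)"
  proof (intro equalityI subsetI)
    fix c assume "c \<in> \<Union>{e \<in> P. e \<subseteq> quadrant n}"
    then obtain e where e: "e \<in> P" "e \<subseteq> quadrant n" "c \<in> e" by auto
    have "c \<notin> x" if "x \<in> P \<inter> crossings n" for x
      using that unique[of e x c] e crossing_not_subset_quadrant by auto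
    then show "c \<in> quadrant n - \<Union>(P \<inter> crossings n)" using e by auto
  next
    fix c assume c: "c \<in> quadrant n - \<Union>(P \<inter> crossings n)"
    then have "c \<in> \<Union>P" using quadrant_subset_diamond P'(3) by auto
    then obtain e where e: "e \<in> P" "c \<in> e" by auto
    then have "e \<subseteq> diamond n" using P'(3) by auto
    then have "e \<subseteq> quadrant n \<or> e \<in> crossings n"
      using e c P'(1) by (intro domino_meets_quadrant) auto
    then show "c \<in> \<Union>{e \<in> P. e \<subseteq> quadrant n}" using e c by auto
  qed
  then show "{e \<in> P. e \<subseteq> quadrant n} \<in> matchings dominoes (quadrant n - \<Union>(P \<inter> crossings n))"
    using P'(1,2) by (auto simp: matchings_def disjoint_def)
qed

text \<open>Any domino of an invariant matching can be moved so that it meets the quadrant. There it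
  is a crossing or lies inside, and moving it back shows that it belongs to the orbits.\<close>

lemma orbit_union_sym_matching:
  assumes P: "P \<in> sym_matchings n"
  shows "orbit_union ((P \<inter> crossings n) \<union> {e \<in> P. e \<subseteq> quadrant n}) = P"
proof (intro equalityI subsetI)
  fix e assume "e \<in> orbit_union ((P \<inter> crossings n) \<union> {e \<in> P. e \<subseteq> quadrant n})"
  then show "e \<in> P" using sym_matchings_closed[OF P] by (auto simp: orbit_union_iff)
next
  fix e assume e: "e \<in> P"
  have P': "P \<subseteq> dominoes" "\<Union>P = diamond n"
    using P by (auto simp: sym_matchings_def matchings_def)
  then obtain c where c: "c \<in> e" using e empty_notin_dominoes by (metis ex_in_conv subsetD)
  then have "c \<in> diamond n" using e P'(2) by auto
  then obtain a b where ab: "symm a b c \<in> quadrant n" by (rule diamond_sym_quadrant)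
  let ?e = "symm a b ` e"
  have eP: "?e \<in> P" using sym_matchings_closed[OF P e] .
  moreover have "?e \<subseteq> diamond n" using eP P'(2) by auto
  moreover have "?e \<inter> quadrant n \<noteq> {}" using ab c by auto
  ultimately have "?e \<subseteq> quadrant n \<or> ?e \<in> crossings n"
    using P'(1) by (intro domino_meets_quadrant) auto
  moreover have "e = symm a b ` ?e" by (simp add: image_sym_sym)
  ultimately show "e \<in> orbit_union ((P \<inter> crossings n) \<union> {e \<in> P. e \<subseteq> quadrant n})"
    unfolding orbit_union_iff using eP by blast
qed

lemma orbit_union_invariant: "(`) (symm a b) ` orbit_union X = orbit_union X"
proof -
  have sub: "(`) (symm a b) ` orbit_union X \<subseteq> orbit_union X" for a b
  proof
    fix e assume "e \<in> (`) (symm a b) ` orbit_union X"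
    then obtain a' b' x where "x \<in> X" "e = symm a b ` symm a' b' ` x"
      by (auto simp: orbit_union_iff)
    then show "e \<in> orbit_union X" unfolding orbit_union_iff image_sym_sym by blast
  qed
  \<comment> \<open>Equality follows from the inclusion for an involution: apply it once
    more.\<close>
  have "orbit_union X = (`) (symm a b) ` (`) (symm a b) ` orbit_union X"
    by (simp only: image_image_sym_sym) simp
  also have "\<dots> \<subseteq> (`) (symm a b) ` orbit_union X"
    using sub by (intro image_mono)
  finally show ?thesis using sub by blast
qed

text \<open>The danger is that two images overlap. Folding a common cell into the quadrant shows
  that both come from the same domino; images of one crossing that share a cell coincide, and a
  domino inside the quadrant has no nontrivial symmetry.\<close>

lemma orbit_union_in_sym_matchings:
  assumes B: "B \<in> crossing_sets n" and M: "M \<in> matchings dominoes (quadrant n - \<Union>B)"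
  shows "orbit_union (B \<union> M) \<in> sym_matchings n"
proof -
  have M': "M \<subseteq> dominoes" "disjoint M" "\<Union>M = quadrant n - \<Union>B"
    using M by (auto simp: matchings_def)
  have B': "B \<subseteq> crossings n" using B by (auto simp: crossing_sets_def)
  have MQ: "e \<subseteq> quadrant n" if "e \<in> M" for e using that M'(3) by auto
  have trace: "d \<in> x" if "x \<in> B \<union> M" "c \<in> x" "symm a b d = c" "d \<in> quadrant n" for x c d a b
    using that(1)
  proof
    assume "x \<in> B"
    then show ?thesis using crossing_trace that B' by blast
  next
    assume "x \<in> M"
    then have "c \<in> quadrant n" using MQ that(2) by auto
    then have "c = d" using sym_quadrant_unique(1)[of c n d n False False a b] that by simp
    then show ?thesis using that by simp
  qed
  have unique: "x = y" if xy: "x \<in> B \<union> M" "y \<in> B \<union> M" "d \<in> x" "d \<in> y" "d \<in> quadrant n" for x y d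
  proof -
    consider "x \<in> B" "y \<in> B" | "x \<in> M" "y \<in> M" | "x \<in> M" "y \<in> B" | "x \<in> B" "y \<in> M"
      using xy(1,2) by blast
    then show ?thesis
    proof cases
      case 1
      then show ?thesis using crossing_sets_disjoint[OF B] that by blast
    next
      case 2
      then show ?thesis using M'(2) that by (auto simp: disjoint_def)
    qed (use M'(3) that in auto)
  qed
  have disj: "symm a b ` x = symm a' b' ` y"
    if x: "x \<in> B \<union> M" and y: "y \<in> B \<union> M" and c: "c \<in> symm a b ` x" "c \<in> symm a' b' ` y" for x y a b a' b' c
  proof -
    obtain u v where u: "u \<in> x" "c = symm a b u" and v: "v \<in> y" "c = symm a' b' v"
      using c by auto
    have diam: "z \<subseteq> diamond n" if "z \<in> B \<union> M" for z
      using that MQ quadrant_subset_diamond crossing_subset_diamond B' by blast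
    then have "c \<in> diamond n" using u x by auto
    then obtain a0 b0 where d: "symm a0 b0 c \<in> quadrant n" by (rule diamond_sym_quadrant)
    let ?d = "symm a0 b0 c"
    \<comment> \<open>\<open>?d\<close> is the common cell folded into the quadrant; undoing both
      symmetries leads back to \<open>u\<close>, and likewise to \<open>v\<close> below.\<close>
    have "symm (a \<noteq> a0) (b \<noteq> b0) ?d = u"
      by (simp only: sym_sym[symmetric] sym_involution u(2))
    moreover have "symm (a' \<noteq> a0) (b' \<noteq> b0) ?d = v"
      by (simp only: sym_sym[symmetric] sym_involution v(2))
    ultimately have "?d \<in> x" "?d \<in> y"
      using trace[OF x u(1) _ d] trace[OF y v(1) _ d] by auto
    then have xy: "x = y" using unique[OF x y] d by simp
    from x show ?thesis
    proof
      assume "x \<in> B"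
      then show ?thesis using sym_crossing_meet[of x n c a b a' b'] c xy B' by auto
    next
      assume "x \<in> M"
      then have "u \<in> quadrant n" "v \<in> quadrant n" using MQ u v xy by auto
      then have "a = a'" "b = b'"
        using sym_quadrant_unique(2,3)[of u n v n a b a' b'] u v by auto
      then show ?thesis using xy by simp
    qed
  qed
  have "orbit_union (B \<union> M) \<subseteq> dominoes"
    using M'(1) B' crossing_dominoes sym_domino by (fastforce simp: orbit_union_iff)
  moreover have "disjoint (orbit_union (B \<union> M))"
  proof (rule disjointI)
    fix e e' assume "e \<in> orbit_union (B \<union> M)" "e' \<in> orbit_union (B \<union> M)" and ne: "e \<noteq> e'"
    then obtain a b x a' b' y where "x \<in> B \<union> M" "y \<in> B \<union> M" "e = symm a b ` x" "e' = symm a' b' ` y"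
      unfolding orbit_union_iff by blast
    with ne disj[of x y _ a b a' b'] show "e \<inter> e' = {}" by blast
  qed
  moreover have "\<Union>(orbit_union (B \<union> M)) = diamond n"
  proof (intro equalityI subsetI)
    fix c assume "c \<in> \<Union>(orbit_union (B \<union> M))"
    then obtain e where "e \<in> orbit_union (B \<union> M)" "c \<in> e" by blast
    then obtain a b x d where x: "x \<in> B \<union> M" "d \<in> x" "c = symm a b d"
      unfolding orbit_union_iff by blast
    then have "d \<in> diamond n"
      using MQ quadrant_subset_diamond crossing_subset_diamond B' by blast
    then show "c \<in> diamond n" using x by simp
  next
    fix c assume "c \<in> diamond n"
    then obtain a b where "symm a b c \<in> quadrant n" by (rule diamond_sym_quadrant)
    then have "symm a b c \<in> \<Union>(B \<union> M)" using M'(3) by auto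
    then obtain x where x: "x \<in> B \<union> M" "symm a b c \<in> x" by blast
    then have "symm a b (symm a b c) \<in> symm a b ` x" by blast
    then have "c \<in> symm a b ` x" by (simp add: sym_involution)
    moreover have "symm a b ` x \<in> orbit_union (B \<union> M)" using x(1) unfolding orbit_union_iff by blast
    ultimately show "c \<in> \<Union>(orbit_union (B \<union> M))" by blast
  qed
  ultimately show ?thesis
    unfolding sym_matchings_def matchings_def by (simp add: orbit_union_invariant)
qed

lemma subset_orbit_union: "X \<subseteq> orbit_union X"
proof
  fix x assume "x \<in> X"
  then show "x \<in> orbit_union X"
    unfolding orbit_union_iff by (intro exI[of _ False] bexI[of _ x]) auto
qed

lemma orbit_union_split:
  assumes B: "B \<subseteq> crossings n" and M: "\<And>e. e \<in> M \<Longrightarrow> e \<subseteq> quadrant n"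
  shows "orbit_union (B \<union> M) \<inter> crossings n = B"
    and "{e \<in> orbit_union (B \<union> M). e \<subseteq> quadrant n} = M"
proof -
  \<comment> \<open>A crossing contains two cells with -1 and 0 in the same coordinate. Whether or
    not that coordinate is reflected, one of them would come from a cell of \<open>x\<close> with
    coordinate -1.\<close>
  have crossM: "symm a b ` x \<notin> crossings n" if "x \<in> M" for a b x
  proof
    assume "symm a b ` x \<in> crossings n"
    then obtain c where "(- 1, c) \<in> symm a b ` x \<and> (0, c) \<in> symm a b ` x
        \<or> (c, - 1) \<in> symm a b ` x \<and> (c, 0) \<in> symm a b ` x"
      by (auto simp: crossings_def cross_left_def cross_bottom_def)
    moreover have "(- 1, k) \<notin> x" "(k, - 1) \<notin> x" for k
      using M[OF \<open>x \<in> M\<close>] by (auto simp: quadrant_def)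
    ultimately show False
      by (auto simp: symm_def flip_def split: if_splits)
  qed
  have "e \<in> B" if e: "e \<in> orbit_union (B \<union> M)" "e \<in> crossings n" for e
  proof -
    obtain a b x where x: "x \<in> B \<union> M" "e = symm a b ` x"
      using e(1) unfolding orbit_union_iff by blast
    then have "x \<in> B" using crossM e(2) by blast
    then show ?thesis using sym_crossing_in_crossings[of x n a b n] x(2) e(2) B by auto
  qed
  then show "orbit_union (B \<union> M) \<inter> crossings n = B"
    using B subset_orbit_union by blast
  have "e \<in> M" if e: "e \<in> orbit_union (B \<union> M)" "e \<subseteq> quadrant n" for e
  proof -
    obtain a b x where x: "x \<in> B \<union> M" "e = symm a b ` x"
      using e(1) unfolding orbit_union_iff by blast
    have "symm a b ` x = x" if "x \<in> M"
    proof -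
      have "symm a b c = c" if "c \<in> x" for c
      proof -
        have "c \<in> quadrant n" "symm a b c \<in> quadrant n"
          using that x(2) e(2) M[OF \<open>x \<in> M\<close>] by auto
        then have "c = symm a b c"
          by (rule sym_quadrant_unique(1)[of _ n _ n a b False False]) simp
        then show ?thesis by simp
      qed
      then show ?thesis by simp
    qed
    moreover have "\<not> symm a b ` x \<subseteq> quadrant n" if "x \<in> B"
      using that B by (auto simp: crossings_def cross_left_def cross_bottom_def quadrant_def symm_def flip_def split: if_splits)
    ultimately show ?thesis using x e(2) by auto
  qed
  then show "{e \<in> orbit_union (B \<union> M). e \<subseteq> quadrant n} = M"
    using M subset_orbit_union by blast
qed

lemma finite_crossing_sets: "finite (crossing_sets n)"
  by (rule finite_subset[of _ "Pow (crossings n)"]) (auto simp: crossing_sets_def crossings_def)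

lemma card_sym_matchings:
  "int (card (sym_matchings n)) = (\<Sum>B\<in>crossing_sets n. num_matchings dominoes (quadrant n - \<Union>B))"
proof -
  let ?S = "SIGMA B:crossing_sets n. matchings dominoes (quadrant n - \<Union>B)"
  have "bij_betw (\<lambda>P. (P \<inter> crossings n, {e \<in> P. e \<subseteq> quadrant n})) (sym_matchings n) ?S"
  proof (rule bij_betw_byWitness[where f' = "\<lambda>(B, M). orbit_union (B \<union> M)"])
    show "\<forall>P\<in>sym_matchings n. (\<lambda>(B, M). orbit_union (B \<union> M))
        (P \<inter> crossings n, {e \<in> P. e \<subseteq> quadrant n}) = P"
      by (simp add: orbit_union_sym_matching)
    show "(\<lambda>P. (P \<inter> crossings n, {e \<in> P. e \<subseteq> quadrant n})) ` sym_matchings n \<subseteq> ?S"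
      by (intro image_subsetI SigmaI sym_matching_split)
    show "(\<lambda>(B, M). orbit_union (B \<union> M)) ` ?S \<subseteq> sym_matchings n"
      using orbit_union_in_sym_matchings by auto
    show "\<forall>x\<in>?S. (\<lambda>P. (P \<inter> crossings n, {e \<in> P. e \<subseteq> quadrant n}))
        ((\<lambda>(B, M). orbit_union (B \<union> M)) x) = x"
    proof (clarify)
      fix B M assume BM: "B \<in> crossing_sets n" "M \<in> matchings dominoes (quadrant n - \<Union>B)"
      then have 1: "B \<subseteq> crossings n" "\<And>e. e \<in> M \<Longrightarrow> e \<subseteq> quadrant n"
        by (auto simp: crossing_sets_def matchings_def)
      show "orbit_union (B \<union> M) \<inter> crossings n = B \<and> {e \<in> orbit_union (B \<union> M). e \<subseteq> quadrant n} = M"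
        using orbit_union_split[OF 1] by simp
    qed
  qed
  then have "card (sym_matchings n) = card ?S" by (rule bij_betw_same_card)
  also have "\<dots> = (\<Sum>B\<in>crossing_sets n. card (matchings dominoes (quadrant n - \<Union>B)))"
    by (rule card_SigmaI) (auto simp: finite_crossing_sets finite_matchings)
  finally show ?thesis by (simp add: num_matchings_def)
qed

section \<open>Tilings as matchings of cells\<close>

definition cover :: "(int \<times> int) set \<Rightarrow> (real \<times> real) set" where
  "cover A = (\<Union>(i, j)\<in>A. unit_square i j)"

lemma cover_Union: "cover (\<Union>P) = \<Union>(cover ` P)"
  by (auto simp: cover_def)

text \<open>Closed squares overlap in their boundaries, but a point without integer coordinates lies
  in exactly one. Such points serve to read off the cells from a union of squares.\<close>

lemma noninteger_in_unit_square:
  assumes "of_int i < x" "x < of_int i + 1" "of_int j < y" "y < of_int j + 1"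
  shows "(x, y) \<in> unit_square k l \<longleftrightarrow> k = i \<and> l = j"
proof
  assume "(x, y) \<in> unit_square k l"
  then have "of_int k \<le> x" "x \<le> of_int k + 1" "of_int l \<le> y" "y \<le> of_int l + 1"
    by (auto simp: unit_square_def)
  then have "k < i + 1" "i < k + 1" "l < j + 1" "j < l + 1"
    using assms by linarith+
  then show "k = i \<and> l = j" by simp
qed (use assms in \<open>auto simp: unit_square_def\<close>)

lemma noninteger_in_cover:
  assumes "of_int i < x" "x < of_int i + 1" "of_int j < y" "y < of_int j + 1"
  shows "(x, y) \<in> cover A \<longleftrightarrow> (i, j) \<in> A"
  using noninteger_in_unit_square[OF assms] by (auto simp: cover_def)

lemma centre_in_cover: "(of_int i + 1 / 2, of_int j + 1 / 2) \<in> cover A \<longleftrightarrow> (i, j) \<in> A"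
  by (rule noninteger_in_cover) auto

lemma inj_cover: "inj cover"
proof (rule injI)
  fix A B assume "cover A = cover B"
  then have "(i, j) \<in> A \<longleftrightarrow> (i, j) \<in> B" for i j
    using centre_in_cover[of i j A] centre_in_cover[of i j B] by simp
  then show "A = B" by auto
qed

lemma noninteger_near:
  fixes x e :: real
  assumes "e > 0"
  obtains i :: int and x' :: real where "of_int i < x'" "x' < of_int i + 1" "\<bar>x' - x\<bar> < e"
proof -
  have fl: "of_int \<lfloor>x\<rfloor> \<le> x" "x < of_int \<lfloor>x\<rfloor> + 1" by linarith+
  then obtain d where "0 < d" "d < min e (of_int \<lfloor>x\<rfloor> + 1 - x)"
    using assms dense[of 0 "min e (of_int \<lfloor>x\<rfloor> + 1 - x)"] by auto
  then show thesis using fl(1) by (intro that[of "\<lfloor>x\<rfloor>" "x + d"]) linarith+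
qed

text \<open>Interiors need not be computed. A common cell contributes its open square to both sides;
  conversely a nonempty open intersection contains a point with no integer coordinate, whose unique
  square belongs to both \<open>A\<close> and \<open>B\<close>.\<close>

lemma interior_cover_disjoint:
  "interior (cover A) \<inter> interior (cover B) = {} \<longleftrightarrow> A \<inter> B = {}"
proof
  assume disj: "interior (cover A) \<inter> interior (cover B) = {}"
  show "A \<inter> B = {}"
  proof (rule equals0I)
    fix c assume "c \<in> A \<inter> B"
    moreover obtain i j where c: "c = (i, j)" by fastforce
    ultimately have ij: "(i, j) \<in> A" "(i, j) \<in> B" by auto
    let ?U = "{of_int i<..<of_int i + 1} \<times> {of_int j<..<of_int j + 1} :: (real \<times> real) set"
    have "open ?U" by (intro open_Times) auto
    moreover have "?U \<subseteq> cover A" "?U \<subseteq> cover B"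
      using ij noninteger_in_cover[of i _ j] by auto
    ultimately have "?U \<subseteq> interior (cover A) \<inter> interior (cover B)"
      by (simp add: interior_maximal)
    moreover have "(of_int i + 1 / 2, of_int j + 1 / 2) \<in> ?U" by auto
    ultimately show False using disj by auto
  qed
next
  assume disj: "A \<inter> B = {}"
  show "interior (cover A) \<inter> interior (cover B) = {}"
  proof (rule equals0I)
    fix p assume p: "p \<in> interior (cover A) \<inter> interior (cover B)"
    obtain x y where xy: "p = (x, y)" by fastforce
    have "open (interior (cover A) \<inter> interior (cover B))" by (intro open_Int open_interior)
    then obtain U V where UV: "open U" "open V" "x \<in> U" "y \<in> V"
      "U \<times> V \<subseteq> interior (cover A) \<inter> interior (cover B)"
      using p xy by (metis mem_Sigma_iff open_prod_elim)
    obtain d e where de: "d > 0" "e > 0" "\<And>x'. \<bar>x' - x\<bar> < d \<Longrightarrow> x' \<in> U" "\<And>y'. \<bar>y' - y\<bar> < e \<Longrightarrow> y' \<in> V"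
      using UV(1-4) unfolding open_dist dist_real_def by metis
    obtain i x' where i: "of_int i < x'" "x' < of_int i + 1" "\<bar>x' - x\<bar> < d"
      using noninteger_near[OF de(1)] by blast
    obtain j y' where j: "of_int j < y'" "y' < of_int j + 1" "\<bar>y' - y\<bar> < e"
      using noninteger_near[OF de(2)] by blast
    have "(x', y') \<in> interior (cover A) \<inter> interior (cover B)"
      using UV(5) de(3)[OF i(3)] de(4)[OF j(3)] by blast
    then have "(x', y') \<in> cover A" "(x', y') \<in> cover B"
      using interior_subset by blast+
    then show False
      using noninteger_in_cover[OF i(1,2) j(1,2)] disj by auto
  qed
qed

lemma is_domino_iff: "is_domino D \<longleftrightarrow> D \<in> cover ` dominoes"
proof
  assume "is_domino D"
  then obtain i j where "D = cover {(i, j), (i + 1, j)} \<or> D = cover {(i, j), (i, j + 1)}"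
    by (auto simp: is_domino_def cover_def)
  moreover have "{(i, j), (i + 1, j)} \<in> dominoes" "{(i, j), (i, j + 1)} \<in> dominoes"
    by (auto simp: dominoes_def)
  ultimately show "D \<in> cover ` dominoes" by blast
next
  assume "D \<in> cover ` dominoes"
  then obtain i j where "D = cover {(i, j), (i + 1, j)} \<or> D = cover {(i, j), (i, j + 1)}"
    unfolding dominoes_def by blast
  then show "is_domino D" by (auto simp: is_domino_def cover_def)
qed

text \<open>As \<open>cover\<close> is injective and turns disjointness of cells into disjointness
  of interiors, tilings and matchings correspond one to one.\<close>

lemma domino_tiling_cover_iff:
  "domino_tiling T (cover S) \<longleftrightarrow> T \<in> (`) cover ` matchings dominoes S"
proof -
  have pw: "pairwise (\<lambda>D D'. interior D \<inter> interior D' = {}) (cover ` P) \<longleftrightarrow> disjoint P" for P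
    using inj_cover by (auto simp: pairwise_def disjnt_def interior_cover_disjoint inj_eq)
  show ?thesis
  proof
    assume T: "domino_tiling T (cover S)"
    then have "T \<subseteq> cover ` dominoes" by (auto simp: domino_tiling_def is_domino_iff)
    then obtain P where P: "P \<subseteq> dominoes" "T = cover ` P" by (auto simp: subset_image_iff)
    moreover have "disjoint P" using T pw P(2) by (simp add: domino_tiling_def)
    moreover have "\<Union>P = S"
      using T P(2) inj_cover by (simp add: domino_tiling_def cover_Union[symmetric] inj_eq)
    ultimately show "T \<in> (`) cover ` matchings dominoes S" by (auto simp: matchings_def)
  next
    assume "T \<in> (`) cover ` matchings dominoes S"
    then obtain P where P: "P \<subseteq> dominoes" "disjoint P" "\<Union>P = S" "T = cover ` P"
      by (auto simp: matchings_def)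
    then have "pairwise (\<lambda>D D'. interior D \<inter> interior D' = {}) T" using pw by simp
    moreover have "\<forall>D\<in>T. is_domino D" using P by (auto simp: is_domino_iff)
    moreover have "\<Union>T = cover S" using P by (simp add: cover_Union[symmetric])
    ultimately show "domino_tiling T (cover S)" by (simp add: domino_tiling_def)
  qed
qed

lemma refl_t_unit_square: "refl_t ` unit_square i j = unit_square (- 1 - i) j"
proof (intro equalityI subsetI)
  fix p assume "p \<in> unit_square (- 1 - i) j"
  then show "p \<in> refl_t ` unit_square i j"
    by (intro image_eqI[of _ _ "refl_t p"]) (auto simp: refl_t_def unit_square_def)
qed (auto simp: refl_t_def unit_square_def)

lemma half_turn_unit_square: "half_turn ` unit_square i j = unit_square (- 1 - i) (- 1 - j)"
proof (intro equalityI subsetI)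
  fix p assume "p \<in> unit_square (- 1 - i) (- 1 - j)"
  then show "p \<in> half_turn ` unit_square i j"
    by (intro image_eqI[of _ _ "half_turn p"]) (auto simp: half_turn_def unit_square_def)
qed (auto simp: half_turn_def unit_square_def)

lemma refl_t_cover: "refl_t ` cover A = cover (symm True False ` A)"
  by (simp add: cover_def image_UN case_prod_beta refl_t_unit_square symm_def flip_def)

lemma half_turn_cover: "half_turn ` cover A = cover (symm True True ` A)"
  by (simp add: cover_def image_UN case_prod_beta half_turn_unit_square symm_def flip_def)

lemma invariant_under_cover_iff:
  assumes "\<And>A. g ` cover A = cover (s ` A)"
  shows "invariant_under g (cover ` P) \<longleftrightarrow> (`) s ` P = P"
proof -
  have "(\<lambda>D. g ` D) ` cover ` P = cover ` (`) s ` P"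
    by (simp add: image_image assms)
  then show ?thesis
    using inj_cover by (simp add: invariant_under_def inj_image_eq_iff)
qed

lemma unit_square_subset_iff:
  "unit_square i j \<subseteq> {(x, y). \<bar>x\<bar> + \<bar>y\<bar> \<le> real (n + 1) + 1} \<longleftrightarrow> (i, j) \<in> diamond n"
proof
  assume sub: "unit_square i j \<subseteq> {(x, y). \<bar>x\<bar> + \<bar>y\<bar> \<le> real (n + 1) + 1}"
  \<comment> \<open>The vertex farthest from the origin. Its coordinates have absolute values
    \<open>fold_int i + 1\<close> and \<open>fold_int j + 1\<close>, so the bound n + 2 becomes n in
    \<open>diamond n\<close>.\<close>
  let ?x = "if i \<ge> 0 then i + 1 else i" and ?y = "if j \<ge> 0 then j + 1 else j"
  have "(real_of_int ?x, real_of_int ?y) \<in> unit_square i j" by (auto simp: unit_square_def)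
  then have "\<bar>real_of_int ?x\<bar> + \<bar>real_of_int ?y\<bar> \<le> real (n + 1) + 1" using sub by blast
  then have "\<bar>?x\<bar> + \<bar>?y\<bar> \<le> int n + 2" by linarith
  then show "(i, j) \<in> diamond n" by (auto simp: diamond_def fold_int_def split: if_splits)
next
  assume "(i, j) \<in> diamond n"
  then have ij: "real_of_int (fold_int i) + real_of_int (fold_int j) \<le> real n"
    by (simp add: diamond_def)
  have bound: "\<bar>x\<bar> \<le> real_of_int (fold_int k) + 1" if "of_int k \<le> x" "x \<le> of_int k + 1" for k :: int and x :: real
    using that by (auto simp: fold_int_def max_def)
  show "unit_square i j \<subseteq> {(x, y). \<bar>x\<bar> + \<bar>y\<bar> \<le> real (n + 1) + 1}"
  proof clarify
    fix x y :: real assume "(x, y) \<in> unit_square i j"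
    then have "\<bar>x\<bar> \<le> real_of_int (fold_int i) + 1" "\<bar>y\<bar> \<le> real_of_int (fold_int j) + 1"
      by (auto simp: unit_square_def intro: bound)
    then show "\<bar>x\<bar> + \<bar>y\<bar> \<le> real (n + 1) + 1" using ij by simp
  qed
qed

lemma aztec_diamond_eq_cover: "aztec_diamond (n + 1) = cover (diamond n)"
proof -
  have "aztec_diamond (n + 1) = \<Union>{unit_square i j | i j. (i, j) \<in> diamond n}"
    unfolding aztec_diamond_def unit_square_subset_iff ..
  then show ?thesis by (auto simp: cover_def)
qed

lemma card_symmetric_tilings:
  "card {T. domino_tiling T (aztec_diamond (n + 1)) \<and> invariant_under refl_t T \<and> invariant_under half_turn T}
    = card (sym_matchings n)"
proof -
  have "{T. domino_tiling T (aztec_diamond (n + 1)) \<and> invariant_under refl_t T \<and> invariant_under half_turn T}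
      = (`) cover ` sym_matchings n"
    unfolding aztec_diamond_eq_cover domino_tiling_cover_iff sym_matchings_def
    using invariant_under_cover_iff[OF refl_t_cover] invariant_under_cover_iff[OF half_turn_cover]
    by auto
  moreover have "inj ((`) cover)"
    by (rule inj_onI) (simp add: inj_image_eq_iff[OF inj_cover])
  ultimately show ?thesis by (simp add: card_image inj_on_subset)
qed

section \<open>Counting crossings\<close>

text \<open>Sequences serve as indicator functions. \<open>R_seq\<close> appears because the chosen
  elements belong to the ones, whereas \<open>zero_cells\<close> selects zeros.\<close>

lemma bij_betw_zero_cells:
  assumes "inj_on x {..<N}"
  shows "bij_betw (\<lambda>\<epsilon>. zero_cells x (R_seq \<epsilon>)) {\<epsilon>. length \<epsilon> = N} (Pow (x ` {..<N}))"
proof (rule bij_betw_byWitness[where f' = "\<lambda>B. map (\<lambda>k. if x k \<in> B then 1 else 0) [0..<N]"])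
  have mem: "x k \<in> zero_cells x (R_seq \<epsilon>) \<longleftrightarrow> \<epsilon> ! k = 1" if "k < N" "length \<epsilon> = N" for k \<epsilon>
  proof -
    have "x k \<in> zero_cells x (R_seq \<epsilon>) \<longleftrightarrow> (\<exists>l<N. x k = x l \<and> \<epsilon> ! l = 1)"
      using that(2) by (auto simp: zero_cells_def nth_R_seq one_minus_bit_eq_0_iff simp del: minus_bit_def)
    also have "\<dots> \<longleftrightarrow> \<epsilon> ! k = 1"
      using that(1) assms by (auto simp: inj_on_eq_iff)
    finally show ?thesis .
  qed
  have sub: "zero_cells x (R_seq \<epsilon>) \<subseteq> x ` {..<N}" if "length \<epsilon> = N" for \<epsilon>
    using that by (auto simp: zero_cells_def)
  show "\<forall>\<epsilon>\<in>{\<epsilon>. length \<epsilon> = N}.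
      map (\<lambda>k. if x k \<in> zero_cells x (R_seq \<epsilon>) then 1 else 0) [0..<N] = \<epsilon>"
    by (auto simp: mem intro!: nth_equalityI)
  show "\<forall>B\<in>Pow (x ` {..<N}). zero_cells x (R_seq (map (\<lambda>k. if x k \<in> B then 1 else 0) [0..<N])) = B"
  proof
    fix B assume B: "B \<in> Pow (x ` {..<N})"
    let ?\<epsilon> = "map (\<lambda>k. if x k \<in> B then 1 else 0 :: bit) [0..<N]"
    have "x k \<in> zero_cells x (R_seq ?\<epsilon>) \<longleftrightarrow> x k \<in> B" if "k < N" for k
      using mem[OF that, of ?\<epsilon>] that by simp
    then show "zero_cells x (R_seq ?\<epsilon>) = B"
      using sub[of ?\<epsilon>] B by auto
  qed
  show "(\<lambda>\<epsilon>. zero_cells x (R_seq \<epsilon>)) ` {\<epsilon>. length \<epsilon> = N} \<subseteq> Pow (x ` {..<N})"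
    using sub by auto
qed auto

lemma quadrant_minus_crossings:
  assumes "length \<epsilon> = 2 * n + 1" "\<And>k. k < 2 * n + 1 \<Longrightarrow> x k \<inter> quadrant n = {axis_cell n k}"
  shows "quadrant n - \<Union>(zero_cells x (R_seq \<epsilon>)) = region n \<epsilon>"
proof -
  have "\<Union>(zero_cells x (R_seq \<epsilon>)) \<inter> quadrant n = (\<Union>k\<in>{k. k < 2 * n + 1 \<and> R_seq \<epsilon> ! k = 0}. x k \<inter> quadrant n)"
    using assms(1) by (auto simp: zero_cells_def)
  also have "\<dots> = zero_cells (axis_cell n) (R_seq \<epsilon>)"
    using assms by (auto simp: zero_cells_def)
  finally show ?thesis unfolding region_def by blast
qed

text \<open>The parameter \<open>b\<close> decides in which direction the corner cell leaves the quadrant.\<close>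

definition axis_crossing :: "bool \<Rightarrow> nat \<Rightarrow> nat \<Rightarrow> (int \<times> int) set" where
  "axis_crossing b n k =
     (if k < n \<or> k = n \<and> \<not> b then cross_left (int n - int k) else cross_bottom (int k - int n))"

lemma cross_inject [simp]:
  "cross_left i = cross_left j \<longleftrightarrow> i = j" "cross_bottom i = cross_bottom j \<longleftrightarrow> i = j"
  "cross_left i \<noteq> cross_bottom j" "cross_bottom j \<noteq> cross_left i"
  by (auto simp: cross_left_def cross_bottom_def doubleton_eq_iff)

lemma inj_axis_crossing: "inj (axis_crossing b n)"
  by (rule injI) (auto simp: axis_crossing_def split: if_splits)

lemma axis_crossing_trace:
  "k < 2 * n + 1 \<Longrightarrow> axis_crossing b n k \<inter> quadrant n = {axis_cell n k}"
  by (auto simp: axis_crossing_def axis_cell_def cross_left_def cross_bottom_def quadrant_def)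

text \<open>For fixed \<open>b\<close> each axis cell has one crossing, so only the other crossing
  of the corner cell is missed.\<close>

lemma image_axis_crossing:
  "axis_crossing b n ` {..<2 * n + 1} = crossings n - {if b then cross_left 0 else cross_bottom 0}"
proof (intro equalityI subsetI)
  fix e assume "e \<in> axis_crossing b n ` {..<2 * n + 1}"
  then show "e \<in> crossings n - {if b then cross_left 0 else cross_bottom 0}"
    by (auto simp: axis_crossing_def crossings_def)
next
  fix e assume "e \<in> crossings n - {if b then cross_left 0 else cross_bottom 0}"
  then have e: "e \<in> crossings n" "e \<noteq> (if b then cross_left 0 else cross_bottom 0)" by simp_all
  from e(1) consider j where "e = cross_left j" "0 \<le> j" "j \<le> int n"
    | i where "e = cross_bottom i" "0 \<le> i" "i \<le> int n"
    by (auto simp: crossings_def)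
  then show "e \<in> axis_crossing b n ` {..<2 * n + 1}"
  proof cases
    case (1 j)
    with e(2) have "b \<longrightarrow> j \<noteq> 0" by auto
    with 1 show ?thesis
      by (intro image_eqI[of _ _ "nat (int n - j)"]) (auto simp: axis_crossing_def)
  next
    case (2 i)
    with e(2) have "\<not> b \<longrightarrow> i \<noteq> 0" by auto
    with 2 show ?thesis
      by (intro image_eqI[of _ _ "nat (int n + i)"]) (auto simp: axis_crossing_def)
  qed
qed

text \<open>Admissible sets without \<open>cross_bottom 0\<close> correspond to all sequences, via
  \<open>b = False\<close>. Those with it must lack \<open>cross_left 0\<close> and correspond, via
  \<open>b = True\<close>, to the sequences with middle entry 1. The second sum is thus the second
  direction for the corner cell.\<close>

lemma sum_crossing_sets:
  "(\<Sum>B\<in>crossing_sets n. num_matchings dominoes (quadrant n - \<Union>B)) =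
    (\<Sum>\<epsilon> | length \<epsilon> = 2 * n + 1. num_matchings dominoes (region n \<epsilon>))
    + (\<Sum>\<epsilon> | length \<epsilon> = 2 * n + 1 \<and> \<epsilon> ! n = 1. num_matchings dominoes (region n \<epsilon>))"
proof -
  let ?f = "\<lambda>B. num_matchings dominoes (quadrant n - \<Union>B)"
  let ?V = "Pow (crossings n - {cross_bottom 0})"
  let ?W = "{B \<in> Pow (crossings n - {cross_left 0}). cross_bottom 0 \<in> B}"
  let ?z = "\<lambda>b \<epsilon>. zero_cells (axis_crossing b n) (R_seq \<epsilon>)"
  let ?L = "{\<epsilon> :: bit list. length \<epsilon> = 2 * n + 1}"
  have fin: "finite (crossings n)" by (simp add: crossings_def)
  have bij: "bij_betw (?z b) ?L (Pow (crossings n - {if b then cross_left 0 else cross_bottom 0}))" for b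
    using bij_betw_zero_cells[of "axis_crossing b n" "2 * n + 1"] inj_axis_crossing[of b n]
    unfolding image_axis_crossing by (simp add: inj_on_subset)
  have region: "?f (?z b \<epsilon>) = num_matchings dominoes (region n \<epsilon>)" if "\<epsilon> \<in> ?L" for b \<epsilon>
    using that quadrant_minus_crossings[of \<epsilon> n "axis_crossing b n"] axis_crossing_trace by simp
  have mem: "cross_bottom 0 \<in> ?z True \<epsilon> \<longleftrightarrow> \<epsilon> ! n = 1" if "\<epsilon> \<in> ?L" for \<epsilon>
  proof -
    have "cross_bottom 0 = axis_crossing True n k \<longleftrightarrow> k = n" for k
      using inj_axis_crossing[of True n] by (auto simp: axis_crossing_def)
    then have "cross_bottom 0 \<in> ?z True \<epsilon> \<longleftrightarrow> R_seq \<epsilon> ! n = 0"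
      using that by (auto simp: zero_cells_def)
    also have "\<dots> \<longleftrightarrow> \<epsilon> ! n = 1"
      using that by (simp add: nth_R_seq one_minus_bit_eq_0_iff del: minus_bit_def)
    finally show ?thesis .
  qed
  have "crossing_sets n = ?V \<union> ?W" by (auto simp: crossing_sets_def)
  moreover have "?V \<inter> ?W = {}" by auto
  ultimately have "sum ?f (crossing_sets n) = sum ?f ?V + sum ?f ?W"
    using fin by (simp add: sum.union_disjoint)
  also have "sum ?f ?V = (\<Sum>\<epsilon>\<in>?L. num_matchings dominoes (region n \<epsilon>))"
    using sum.reindex_bij_betw[OF bij[of False], of ?f] region by simp
  also have "sum ?f ?W = (\<Sum>\<epsilon> | length \<epsilon> = 2 * n + 1 \<and> \<epsilon> ! n = 1. num_matchings dominoes (region n \<epsilon>))"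
  proof -
    have "bij_betw (?z True) {\<epsilon> \<in> ?L. \<epsilon> ! n = 1} ?W"
    proof (rule bij_betw_subset[OF bij[of True]])
      have "Pow (crossings n - {cross_left 0}) = ?z True ` ?L"
        using bij[of True] by (simp add: bij_betw_def)
      then have "?W = {B \<in> ?z True ` ?L. cross_bottom 0 \<in> B}" by simp
      also have "\<dots> = ?z True ` {\<epsilon> \<in> ?L. \<epsilon> ! n = 1}" using mem by blast
      finally show "?z True ` {\<epsilon> \<in> ?L. \<epsilon> ! n = 1} = ?W" by simp
    qed auto
    from sum.reindex_bij_betw[OF this, of ?f] show ?thesis using region by simp
  qed
  finally show ?thesis .
qed

theorem theorem4:
  fixes n :: nat
  assumes "n \<ge> 1"
  shows "int (card {T. domino_tiling T (aztec_diamond (n + 1)) \<and>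
                       invariant_under refl_t T \<and> invariant_under half_turn T})
         = (\<Sum>\<epsilon> | length \<epsilon> = 2 * n + 1 \<and> \<epsilon> ! n = 0. C' n \<epsilon>)
           + (\<Sum>\<epsilon> | length \<epsilon> = 2 * n + 1 \<and> \<epsilon> ! n = 1. 2 * C' n \<epsilon>)"
proof -
  let ?Z = "{\<epsilon> :: bit list. length \<epsilon> = 2 * n + 1 \<and> \<epsilon> ! n = 0}"
  let ?O = "{\<epsilon> :: bit list. length \<epsilon> = 2 * n + 1 \<and> \<epsilon> ! n = 1}"
  have "finite (UNIV :: bit set)" by (rule finite_subset[of _ "{0, 1}"]) auto
  then have fin: "finite {\<epsilon> :: bit list. length \<epsilon> = 2 * n + 1}"
    using finite_lists_length_eq[of "UNIV :: bit set" "2 * n + 1"] by simp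
  have split: "{\<epsilon> :: bit list. length \<epsilon> = 2 * n + 1} = ?Z \<union> ?O" by auto
  have "int (card {T. domino_tiling T (aztec_diamond (n + 1)) \<and>
                       invariant_under refl_t T \<and> invariant_under half_turn T})
    = (\<Sum>\<epsilon> | length \<epsilon> = 2 * n + 1. C' n \<epsilon>) + (\<Sum>\<epsilon>\<in>?O. C' n \<epsilon>)"
    unfolding card_symmetric_tilings card_sym_matchings sum_crossing_sets
    using C'_eq_num_matchings[OF assms] by simp
  \<comment> \<open>Sequences with middle entry 1 occur once in this full sum and once more in the
    extra sum, which gives the factor 2.\<close>
  also have "(\<Sum>\<epsilon> | length \<epsilon> = 2 * n + 1. C' n \<epsilon>) = (\<Sum>\<epsilon>\<in>?Z. C' n \<epsilon>) + (\<Sum>\<epsilon>\<in>?O. C' n \<epsilon>)"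
    unfolding split using fin by (intro sum.union_disjoint) (auto elim: rev_finite_subset)
  finally show ?thesis by (simp add: sum_distrib_left[symmetric])
qed

end
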